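(* Let $(\mathbf d_n)_{n\in\mathbb N}$ be a sequence of bi-degree sequences $\mathbf d_n=((d_1^-,d_1^+),\dots,(d_n^-,d_n^+))$ for which there exist constants $\eta,C>0$ and $K\ge 2$ such that for all $n$: (i) $\min_{v\in[n]}d_v^+\ge 2$; (ii) $\max_{v\in[n]}d_v^+\le K$; (iii) $\sum_{v\in[n]}(d_v^-)^{2+\eta}\le Cn$. Assume that the empirical in-degree distribution $\phi=\phi_n=\frac1n\sum_{v\in[n]}\delta_{d_v^-}$ has power-law behavior with index $\kappa>2$ (see context). Let $\alpha\in(0,1)$ be any constant and let $\lambda=\lambda_n$ be a probability distribution on $[n]$ such that for all $\varepsilon>0$, for all sufficiently large $n$, $n^{-1-\varepsilon}\le\lambda(x)\le n^{-1+\varepsilon}$ uniformly in $x\in[n]$. Let $P$ be the transition matrix of the simple random walk on the directed configuration model $G_n$ with bi-degree sequence $\mathbf d_n$, let $\pi_{\alpha,\lambda}$ be the unique stationary distribution of the Markov chain on $[n]$ with transition matrix $P_{\alpha,\lambda}(x,y)=(1-\alpha)P(x,y)+\alpha\lambda(y)$, and let $\psi_{\alpha,\lambda}=\frac1n\sum_{v\in[n]}\delta_{n\pi_{\alpha,\lambda}(v)}$. Then, with high probability, $\psi_{\alpha,\lambda}$ has power-law behavior with the same index $\kappa$; that is, for all $\varepsilon>0$, with high probability, $\psi_{\alpha,\lambda}(n^{1/\kappa+\varepsilon},\infty)=0$ and for all $a\in(0,1/\kappa)$, $$n^{-a\kappa-\varepsilon}\le\psi_{\alpha,\lambda}(n^a,\infty)\le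 n^{-a\kappa+\varepsilon}.$$
   Context: Directed configuration model: given a bi-degree sequence of nonnegative integers with $m:=\sum_{v\in[n]}d_v^+=\sum_{v\in[n]}d_v^-$, attach $d_v^-$ heads and $d_v^+$ tails to each vertex $v\in[n]=\{1,\dots,n\}$, match the $m$ tails to the $m$ heads by a uniformly random bijection, and add a directed edge $(u,v)$ for each tail of $u$ matched to a head of $v$; the result is the random directed multigraph $G=G_n$. The simple random walk on $G$ has transition matrix $P(y,x)=m(y,x)/d_y^+$, with $m(y,x)$ the multiplicity of the edge $(y,x)$. "With high probability" means with probability tending to $1$ as $n\to\infty$. The distribution $\pi_{\alpha,\lambda}$ (the PageRank score with teleporting probability $\alpha$ and teleporting distribution $\lambda$) satisfies $\pi_{\alpha,\lambda}=\sum_{k\ge0}\alpha(1-\alpha)^k\lambda P^k$. For an empirical measure $\mu_n=\frac1n\sum_{v\in[n]}\delta_{x_v}$ with $x_v\ge0$, and $t\ge0$, write $\mu_n(t,\infty)=\frac1n|\{v\in[n]:x_v>t\}|$. A sequence $(\mu_n)$ of such measures has power-law behavior with index $\kappa>0$ if for all $\varepsilon>0$ and for all $a\in(0,1/\kappa)$, $$n^{-a\kappa-\varepsilon}\le\mu_n(n^a,\infty)\le n^{-a\kappa+\varepsilon},\qquad \mu_n(n^{1/\kappa+\varepsilon},\infty)=0,\qquad( * )$$ for all sufficiently large $n$. If the measures $\mu_n$ are random, $\mu_n$ has power-law behavior with index $\kappa$ with high probability if for all $\varepsilon>0$, with high probability $( * )$ holds for any $a\in(0,1/\kappa)$.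
   Formalization: The lower bound is claimed with high probability simultaneously for all a in (0,b], for each fixed b<1/κ, rather than for all a in (0,1/κ) at once, which is false since it would force max nπ(v) ≥ n^{1/κ}; the cutoff and the upper bound are as stated. *)

theory Defs
  imports "HOL-Probability.Probability"
begin

section \<open>The directed configuration model\<close>

text \<open>The vertex set is \<open>{1..n}\<close>; \<open>dm v\<close> and \<open>dp v\<close> are the in- and out-degree of \<open>v\<close>.
  The \<open>i\<close>-th half-edge of a given kind at \<open>v\<close> is \<open>(v, i)\<close>.\<close>

definition half_edges :: "nat \<Rightarrow> (nat \<Rightarrow> nat) \<Rightarrow> (nat \<times> nat) set" where
  "half_edges n d = (SIGMA v:{1..n}. {..<d v})"

definition matchings ::
    "nat \<Rightarrow> (nat \<Rightarrow> nat) \<Rightarrow> (nat \<Rightarrow> nat) \<Rightarrow> (nat \<times> nat \<Rightarrow> nat \<times> nat) set" where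
  "matchings n dm dp =
     {\<sigma> \<in> half_edges n dp \<rightarrow>\<^sub>E half_edges n dm. bij_betw \<sigma> (half_edges n dp) (half_edges n dm)}"

text \<open>A directed multigraph is represented by its multiset of edges.\<close>

definition graph_of_matching ::
    "nat \<Rightarrow> (nat \<Rightarrow> nat) \<Rightarrow> (nat \<times> nat \<Rightarrow> nat \<times> nat) \<Rightarrow> (nat \<times> nat) multiset" where
  "graph_of_matching n dp \<sigma> = image_mset (\<lambda>t. (fst t, fst (\<sigma> t))) (mset_set (half_edges n dp))"

definition dcm :: "nat \<Rightarrow> (nat \<Rightarrow> nat) \<Rightarrow> (nat \<Rightarrow> nat) \<Rightarrow> (nat \<times> nat) multiset pmf" where
  "dcm n dm dp = map_pmf (graph_of_matching n dp) (pmf_of_set (matchings n dm dp))"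


section \<open>Random walk and PageRank\<close>

definition srw_matrix :: "(nat \<Rightarrow> nat) \<Rightarrow> (nat \<times> nat) multiset \<Rightarrow> nat \<Rightarrow> nat \<Rightarrow> real" where
  "srw_matrix dp G y x = real (count G (y, x)) / real (dp y)"

definition pagerank_matrix ::
    "real \<Rightarrow> nat pmf \<Rightarrow> (nat \<Rightarrow> nat \<Rightarrow> real) \<Rightarrow> nat \<Rightarrow> nat \<Rightarrow> real" where
  "pagerank_matrix \<alpha> lam P x y = (1 - \<alpha>) * P x y + \<alpha> * pmf lam y"

definition stationary_distribution :: "nat set \<Rightarrow> (nat \<Rightarrow> nat \<Rightarrow> real) \<Rightarrow> nat pmf \<Rightarrow> bool" where
  "stationary_distribution V Q \<pi> \<longleftrightarrow>
     set_pmf \<pi> \<subseteq> V \<and> (\<forall>y\<in>V. pmf \<pi> y = (\<Sum>x\<in>V. pmf \<pi> x * Q x y))"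

definition pagerank :: "nat \<Rightarrow> real \<Rightarrow> nat pmf \<Rightarrow> (nat \<Rightarrow> nat \<Rightarrow> real) \<Rightarrow> nat pmf" where
  "pagerank n \<alpha> lam P = (THE \<pi>. stationary_distribution {1..n} (pagerank_matrix \<alpha> lam P) \<pi>)"


section \<open>Empirical measures and power-law behavior\<close>

definition empirical_measure :: "nat \<Rightarrow> (nat \<Rightarrow> real) \<Rightarrow> real pmf" where
  "empirical_measure n x = map_pmf x (pmf_of_set {1..n})"

abbreviation tail :: "real pmf \<Rightarrow> real \<Rightarrow> real" where
  "tail \<mu> t \<equiv> measure_pmf.prob \<mu> {t<..}"

lemma tail_empirical_measure:
  assumes "n \<ge> 1"
  shows "tail (empirical_measure n x) t = real (card {v \<in> {1..n}. x v > t}) / real n"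
proof -
  have "x -` {t<..} \<inter> {1..n} = {v \<in> {1..n}. x v > t}"
    by auto
  then show ?thesis
    using assms by (simp add: empirical_measure_def measure_pmf_of_set Int_commute)
qed

definition pl_lower :: "real \<Rightarrow> real \<Rightarrow> real \<Rightarrow> nat \<Rightarrow> real pmf \<Rightarrow> bool" where
  "pl_lower \<kappa> \<epsilon> a n \<mu> \<longleftrightarrow> real n powr (- a * \<kappa> - \<epsilon>) \<le> tail \<mu> (real n powr a)"

definition pl_upper :: "real \<Rightarrow> real \<Rightarrow> real \<Rightarrow> nat \<Rightarrow> real pmf \<Rightarrow> bool" where
  "pl_upper \<kappa> \<epsilon> a n \<mu> \<longleftrightarrow> tail \<mu> (real n powr a) \<le> real n powr (- a * \<kappa> + \<epsilon>)"

definition pl_cutoff :: "real \<Rightarrow> real \<Rightarrow> nat \<Rightarrow> real pmf \<Rightarrow> bool" where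
  "pl_cutoff \<kappa> \<epsilon> n \<mu> \<longleftrightarrow> tail \<mu> (real n powr (1 / \<kappa> + \<epsilon>)) = 0"

definition power_law :: "real \<Rightarrow> (nat \<Rightarrow> real pmf) \<Rightarrow> bool" where
  "power_law \<kappa> \<mu> \<longleftrightarrow> \<kappa> > 0 \<and>
     (\<forall>\<epsilon>>0. \<forall>a\<in>{0<..<1/\<kappa>}. \<forall>\<^sub>F n in sequentially.
        pl_lower \<kappa> \<epsilon> a n (\<mu> n) \<and> pl_upper \<kappa> \<epsilon> a n (\<mu> n) \<and> pl_cutoff \<kappa> \<epsilon> n (\<mu> n))"

definition whp :: "(nat \<Rightarrow> 'a pmf) \<Rightarrow> (nat \<Rightarrow> 'a \<Rightarrow> bool) \<Rightarrow> bool" where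
  "whp M E \<longleftrightarrow> (\<lambda>n. measure_pmf.prob (M n) {\<omega>. E n \<omega>}) \<longlonglongrightarrow> 1"

text \<open>Power-law behavior with high probability of the random measures \<open>\<mu> n \<omega>\<close>, \<open>\<omega>\<close> distributed
  as \<open>M n\<close>. The cutoff and the upper bound hold simultaneously for all \<open>a \<in> (0, 1/\<kappa>)\<close> on a single
  event. The lower bound holds simultaneously for all \<open>a \<in> (0, b]\<close>, where \<open>b < 1/\<kappa>\<close> is arbitrary
  but does not depend on \<open>n\<close>: for fixed \<open>n\<close>, the lower bound for all \<open>a < 1/\<kappa>\<close> at once would
  force an atom in \<open>{n powr (1/\<kappa>)..}\<close>, which \<open>power_law \<kappa>\<close> does not force
  even for deterministic measures (the largest atom may be \<open>n powr (1/\<kappa>) / ln n\<close>).\<close>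

definition power_law_whp ::
    "real \<Rightarrow> (nat \<Rightarrow> 'a pmf) \<Rightarrow> (nat \<Rightarrow> 'a \<Rightarrow> real pmf) \<Rightarrow> bool" where
  "power_law_whp \<kappa> M \<mu> \<longleftrightarrow> \<kappa> > 0 \<and>
     (\<forall>\<epsilon>>0. \<forall>b\<in>{0<..<1/\<kappa>}. whp M (\<lambda>n \<omega>.
        pl_cutoff \<kappa> \<epsilon> n (\<mu> n \<omega>) \<and>
        (\<forall>a\<in>{0<..<1/\<kappa>}. pl_upper \<kappa> \<epsilon> a n (\<mu> n \<omega>)) \<and>
        (\<forall>a\<in>{0<..b}. pl_lower \<kappa> \<epsilon> a n (\<mu> n \<omega>))))"

end

theory Submission
  imports Defs "HOL-Real_Asymp.Real_Asymp"
begin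

text \<open>Write \<open>\<pi>\<close> as the law of the walk started from \<open>lam\<close> and stopped at an independent geometric
  time. Paths of length one already give \<open>n \<pi>(v) \<ge> n\<^sup>-\<^sup>\<epsilon> d\<^sup>-(v)\<close> up to constants on every graph, hence the
  lower tail bound. For the upper tail bound at \<open>n\<^sup>a\<close>, let \<open>B\<close> be the set of vertices of in-degree above
  \<open>n\<^sup>a\<^sup>'\<close> with \<open>a'\<close> slightly smaller than \<open>a\<close>, and ignore walks of length more than a multiple of \<open>log n\<close>.
  The \<open>p\<close>-th moment of the mass that reaches \<open>v\<close> while avoiding \<open>B\<close> is the probability that \<open>p\<close>
  independent walks all do so. Revealing the matching along these walks exposes only
  \<open>O(p log n)\<close> edges, and each new walk has to enter the exposed vertices through a fresh head, which
  costs \<open>n\<^sup>a\<^sup>'\<^sup>-\<^sup>1\<^sup>+\<^sup>o\<^sup>(\<^sup>1\<^sup>)\<close>. For large \<open>p\<close>, Markov's inequality and a union bound show that this mass is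
  below \<open>n\<^sup>a\<^sup>-\<^sup>1\<close> at all \<open>v\<close>. The total mass of the walks that meet \<open>B\<close> has mean about
  \<open>d\<^sup>-(B) / n\<close>, which bounds the number of vertices where it is large, and vanishes when \<open>a > 1/\<kappa>\<close>.\<close>

section \<open>Counting half-edges\<close>

lemma finite_half_edges [simp]: "finite (half_edges n d)"
  by (simp add: half_edges_def)

lemma card_half_edges: "card (half_edges n d) = (\<Sum>v\<in>{1..n}. d v)"
  by (simp add: half_edges_def)

lemma card_half_edges_vertices:
  assumes "A \<subseteq> {1..n}"
  shows "card {h \<in> half_edges n d. fst h \<in> A} = (\<Sum>v\<in>A. d v)"
proof -
  have "{h \<in> half_edges n d. fst h \<in> A} = (SIGMA v:A. {..<d v})"
    using assms by (auto simp: half_edges_def)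
  moreover have "finite A"
    using assms finite_subset by blast
  ultimately show ?thesis
    by simp
qed

section \<open>Killed random walks\<close>

text \<open>The transition operator of the walk applied to \<open>f\<close>, written with half-edges
  so that it reads the matching one tail at a time. At out-degree 0 it gives 0, so the bounds by 1
  hold for every \<open>dp\<close>.\<close>

definition step :: "(nat \<Rightarrow> nat) \<Rightarrow> (nat \<times> nat \<Rightarrow> nat \<times> nat) \<Rightarrow> (nat \<Rightarrow> real) \<Rightarrow> nat \<Rightarrow> real" where
  "step dp \<sigma> f u = (\<Sum>i<dp u. f (fst (\<sigma> (u, i)))) / real (dp u)"

lemma step_mono:
  assumes "\<And>i. i < dp u \<Longrightarrow> f (fst (\<sigma> (u, i))) \<le> g (fst (\<sigma> (u, i)))"
  shows "step dp \<sigma> f u \<le> step dp \<sigma> g u"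
  unfolding step_def using assms by (intro divide_right_mono sum_mono) auto

lemma step_nonneg: "(\<And>x. 0 \<le> f x) \<Longrightarrow> 0 \<le> step dp \<sigma> f u"
  unfolding step_def by (intro divide_nonneg_nonneg sum_nonneg) auto

lemma step_le_1:
  assumes "\<And>x. f x \<le> 1"
  shows "step dp \<sigma> f u \<le> 1"
proof -
  have "(\<Sum>i<dp u. f (fst (\<sigma> (u, i)))) \<le> real (dp u)"
    using sum_mono[of "{..<dp u}" "\<lambda>i. f (fst (\<sigma> (u, i)))" "\<lambda>_. 1"] assms by simp
  then show ?thesis
    unfolding step_def by (cases "dp u = 0") (auto simp: divide_le_eq)
qed

lemma step_diff: "step dp \<sigma> (\<lambda>x. f x - g x) u = step dp \<sigma> f u - step dp \<sigma> g u"
  by (simp add: step_def sum_subtractf diff_divide_distrib)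

lemma step_sum: "step dp \<sigma> (\<lambda>x. \<Sum>j\<in>J. f j x) u = (\<Sum>j\<in>J. step dp \<sigma> (f j) u)"
  unfolding step_def by (subst sum.swap) (simp add: sum_divide_distrib)

text \<open>For a fixed matching, the probability that the walk from \<open>u\<close> is at
  \<open>v\<close> at time \<open>k\<close> and avoids \<open>B\<close> at all times from 0 to
  \<open>k\<close>, both endpoints included. The recursion peels off the first step because edges
  are revealed in that order.\<close>

primrec walk ::
    "(nat \<Rightarrow> nat) \<Rightarrow> (nat \<times> nat \<Rightarrow> nat \<times> nat) \<Rightarrow> nat set \<Rightarrow> nat \<Rightarrow> nat \<Rightarrow> nat \<Rightarrow> real" where
  "walk dp \<sigma> B v 0 u = of_bool (u = v \<and> u \<notin> B)"
| "walk dp \<sigma> B v (Suc k) u = (if u \<in> B then 0 else step dp \<sigma> (walk dp \<sigma> B v k) u)"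

text \<open>The probability of a visit to \<open>B\<close> by time \<open>k\<close>, time 0
  included.\<close>

primrec hit ::
    "(nat \<Rightarrow> nat) \<Rightarrow> (nat \<times> nat \<Rightarrow> nat \<times> nat) \<Rightarrow> nat set \<Rightarrow> nat \<Rightarrow> nat \<Rightarrow> real" where
  "hit dp \<sigma> B 0 u = of_bool (u \<in> B)"
| "hit dp \<sigma> B (Suc k) u = (if u \<in> B then 1 else step dp \<sigma> (hit dp \<sigma> B k) u)"

lemma walk_nonneg: "0 \<le> walk dp \<sigma> B v k u"
  by (induction k arbitrary: u) (auto intro: step_nonneg)

lemma walk_le_1: "walk dp \<sigma> B v k u \<le> 1"
  by (induction k arbitrary: u) (auto intro: step_le_1)

lemma walk_killed: "u \<in> B \<Longrightarrow> walk dp \<sigma> B v k u = 0"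
  by (cases k) auto

lemma hit_nonneg: "0 \<le> hit dp \<sigma> B k u"
  by (induction k arbitrary: u) (auto intro: step_nonneg)

lemma hit_le_1: "hit dp \<sigma> B k u \<le> 1"
  by (induction k arbitrary: u) (auto intro: step_le_1)

lemma walk_avoiding_le: "walk dp \<sigma> B v k u \<le> walk dp \<sigma> {} v k u"
  by (induction k arbitrary: u) (auto intro: step_mono step_nonneg walk_nonneg)

lemma sum_walk_le_1:
  assumes "finite V"
  shows "(\<Sum>v\<in>V. walk dp \<sigma> {} v k u) \<le> 1"
proof (induction k arbitrary: u)
  case 0
  then show ?case
    using assms by (simp add: of_bool_def sum.delta)
next
  case (Suc k)
  then show ?case
    by (simp add: step_sum[symmetric] step_le_1)
qed

text \<open>The difference keeps exactly the paths that meet \<open>B\<close>; summing over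
  endpoints forgets where they go afterwards.\<close>

lemma sum_walk_through_le_hit:
  assumes "finite V"
  shows "(\<Sum>v\<in>V. walk dp \<sigma> {} v k u - walk dp \<sigma> B v k u) \<le> hit dp \<sigma> B k u"
proof (induction k arbitrary: u)
  case 0
  then show ?case
    using assms by (auto simp: of_bool_def sum.delta)
next
  case (Suc k)
  show ?case
  proof (cases "u \<in> B")
    case True
    then show ?thesis
      using sum_walk_le_1[OF assms, of dp \<sigma> "Suc k" u] by simp
  next
    case False
    have "(\<Sum>v\<in>V. walk dp \<sigma> {} v (Suc k) u - walk dp \<sigma> B v (Suc k) u) =
        step dp \<sigma> (\<lambda>x. \<Sum>v\<in>V. walk dp \<sigma> {} v k x - walk dp \<sigma> B v k x) u"
      using False by (simp add: step_sum step_diff)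
    also have "\<dots> \<le> step dp \<sigma> (hit dp \<sigma> B k) u"
      by (intro step_mono Suc)
    finally show ?thesis
      using False by simp
  qed
qed

section \<open>Revealing the matching edge by edge\<close>

locale configuration_model =
  fixes n :: nat and dm dp :: "nat \<Rightarrow> nat"
  assumes degree_sums: "(\<Sum>v\<in>{1..n}. dp v) = (\<Sum>v\<in>{1..n}. dm v)"
begin

abbreviation tails :: "(nat \<times> nat) set" where "tails \<equiv> half_edges n dp"
abbreviation heads :: "(nat \<times> nat) set" where "heads \<equiv> half_edges n dm"
abbreviation edges :: nat where "edges \<equiv> card heads"

text \<open>The matchings compatible with a set \<open>R\<close> of revealed edges.\<close>

definition ext :: "((nat \<times> nat) \<times> (nat \<times> nat)) set \<Rightarrow> (nat \<times> nat \<Rightarrow> nat \<times> nat) set" where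
  "ext R = {\<sigma> \<in> matchings n dm dp. \<forall>(t, h) \<in> R. \<sigma> t = h}"

lemma ext_empty [simp]: "ext {} = matchings n dm dp"
  by (simp add: ext_def)

lemma finite_matchings [simp]: "finite (matchings n dm dp)"
  unfolding matchings_def by (rule finite_subset[OF _ finite_PiE[of tails "\<lambda>_. heads"]]) auto

lemma finite_ext [simp]: "finite (ext R)"
  by (simp add: ext_def)

lemma matchings_nonempty: "matchings n dm dp \<noteq> {}"
proof -
  have "card tails = card heads"
    using degree_sums by (simp add: card_half_edges)
  then obtain f where f: "bij_betw f tails heads"
    by (metis finite_half_edges finite_same_card_bij)
  then have "restrict f tails \<in> matchings n dm dp"
    unfolding matchings_def using bij_betw_restrict_eq bij_betw_apply by fastforce
  then show ?thesis
    by blast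
qed

lemma matching_in_heads: "\<sigma> \<in> matchings n dm dp \<Longrightarrow> t \<in> tails \<Longrightarrow> \<sigma> t \<in> heads"
  by (auto simp: matchings_def)

text \<open>The law of total probability in counting form. The tail \<open>t\<close> may already
  occur in \<open>R\<close>: then only its revealed head can give a nonempty class.\<close>

lemma sum_ext_reveal:
  assumes "t \<in> tails"
  shows "sum f (ext R) = (\<Sum>h\<in>heads. sum f (ext (insert (t, h) R)))"
proof -
  have "ext R = (\<Union>h\<in>heads. ext (insert (t, h) R))"
    using assms by (auto simp: ext_def intro!: matching_in_heads)
  moreover have "sum f (\<Union>h\<in>heads. ext (insert (t, h) R)) = (\<Sum>h\<in>heads. sum f (ext (insert (t, h) R)))"
    by (rule sum.UNION_disjoint) (auto simp: ext_def)
  ultimately show ?thesis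
    by simp
qed

lemma card_ext_reveal:
  assumes "t \<in> tails"
  shows "card (ext R) = (\<Sum>h\<in>heads. card (ext (insert (t, h) R)))"
  using sum_ext_reveal[OF assms, of "\<lambda>_. 1::nat" R] by simp

text \<open>Exchanging the heads \<open>h\<close> and \<open>h'\<close> is injective.\<close>

lemma card_ext_swap:
  assumes t: "t \<in> tails" "t \<notin> Domain R"
    and R: "R \<subseteq> tails \<times> heads"
    and h: "h \<in> heads - Range R" "h' \<in> heads - Range R"
  shows "card (ext (insert (t, h) R)) \<le> card (ext (insert (t, h') R))"
proof (rule card_inj_on_le)
  let ?\<phi> = "\<lambda>\<sigma>. restrict (Transposition.transpose h h' \<circ> \<sigma>) tails"
  show "inj_on ?\<phi> (ext (insert (t, h) R))"
  proof (rule inj_onI)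
    fix \<sigma> \<tau>
    assume \<sigma>: "\<sigma> \<in> ext (insert (t, h) R)" and \<tau>: "\<tau> \<in> ext (insert (t, h) R)"
      and eq: "?\<phi> \<sigma> = ?\<phi> \<tau>"
    show "\<sigma> = \<tau>"
    proof (rule PiE_ext)
      show "\<sigma> \<in> tails \<rightarrow>\<^sub>E heads" "\<tau> \<in> tails \<rightarrow>\<^sub>E heads"
        using \<sigma> \<tau> by (auto simp: ext_def matchings_def)
      fix x assume "x \<in> tails"
      then have "Transposition.transpose h h' (\<sigma> x) = Transposition.transpose h h' (\<tau> x)"
        using fun_cong[OF eq, of x] by simp
      then show "\<sigma> x = \<tau> x"
        by (metis transpose_involutory)
    qed
  qed
  show "?\<phi> ` ext (insert (t, h) R) \<subseteq> ext (insert (t, h') R)"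
  proof safe
    fix \<sigma> assume \<sigma>: "\<sigma> \<in> ext (insert (t, h) R)"
    then have bij: "bij_betw \<sigma> tails heads"
      by (auto simp: ext_def matchings_def)
    have "bij_betw (Transposition.transpose h h') heads heads"
      using h by (intro permutes_imp_bij permutes_swap_id) auto
    then have b: "bij_betw (Transposition.transpose h h' \<circ> \<sigma>) tails heads"
      using bij bij_betw_trans by blast
    then have "bij_betw (?\<phi> \<sigma>) tails heads"
      by (subst bij_betw_restrict_eq)
    moreover have "?\<phi> \<sigma> \<in> tails \<rightarrow>\<^sub>E heads"
      using bij_betw_apply[OF b] by (simp add: PiE_iff)
    moreover have "?\<phi> \<sigma> t = h'"
      using \<sigma> t by (simp add: ext_def)
    \<comment> \<open>Neither \<open>h\<close> nor \<open>h'\<close> is a revealed head, so the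
      transposition leaves the edges of \<open>R\<close> intact.\<close>
    moreover have "?\<phi> \<sigma> s = g" if "(s, g) \<in> R" for s g
    proof -
      have "\<sigma> s = g" "s \<in> tails" "g \<noteq> h" "g \<noteq> h'"
        using that \<sigma> R h by (auto simp: ext_def)
      then show ?thesis
        by simp
    qed
    ultimately show "?\<phi> \<sigma> \<in> ext (insert (t, h') R)"
      unfolding ext_def matchings_def by blast
  qed
qed simp

text \<open>Given the revealed edges, the head of \<open>t\<close> is uniform on the unrevealed
  heads: by the exchange argument they all have the same count, there are at least
  \<open>edges - card R\<close> of them, and the counts add up to at most
  \<open>card (ext R)\<close>. A head that is already taken has count 0.\<close>

lemma card_ext_insert:
  assumes t: "t \<in> tails" "t \<notin> Domain R"
    and R: "R \<subseteq> tails \<times> heads"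
    and h: "h \<in> heads"
  shows "(edges - card R) * card (ext (insert (t, h) R)) \<le> card (ext R)"
proof (cases "h \<in> Range R")
  case True
  then obtain s where s: "(s, h) \<in> R" "s \<in> tails" "s \<noteq> t"
    using R t by auto
  have False if "\<sigma> \<in> ext (insert (t, h) R)" for \<sigma>
  proof -
    have "\<sigma> s = \<sigma> t" "inj_on \<sigma> tails"
      using that s by (auto simp: ext_def matchings_def bij_betw_def)
    then show False
      using s t by (auto dest: inj_onD)
  qed
  then have "ext (insert (t, h) R) = {}"
    by blast
  then show ?thesis
    by simp
next
  case False
  have finR: "finite R"
    using R by (rule finite_subset) simp
  have "edges - card R \<le> edges - card (Range R)"
    by (metis Range_snd card_image_le diff_le_mono2 finR)
  also have "\<dots> \<le> card (heads - Range R)"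
    by (intro diff_card_le_card_Diff finite_Range finR)
  finally have "(edges - card R) * card (ext (insert (t, h) R))
      \<le> (\<Sum>h'\<in>heads - Range R. card (ext (insert (t, h) R)))"
    by (simp only: sum_constant of_nat_id mult_le_mono1)
  also have "\<dots> \<le> (\<Sum>h'\<in>heads - Range R. card (ext (insert (t, h') R)))"
    using False h by (intro sum_mono card_ext_swap t R) auto
  also have "\<dots> \<le> (\<Sum>h'\<in>heads. card (ext (insert (t, h') R)))"
    by (intro sum_mono2) auto
  also have "\<dots> = card (ext R)"
    by (rule card_ext_reveal[OF t(1), symmetric])
  finally show ?thesis .
qed

text \<open>The denominator is frozen at the total budget \<open>N\<close> of revealed edges, so
  that one bound serves every stage of the exposure.\<close>

lemma card_ext_insert_real:
  assumes "t \<in> tails" "t \<notin> Domain R" "R \<subseteq> tails \<times> heads" "h \<in> heads"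
    and N: "card R \<le> N" "N < edges"
  shows "real (card (ext (insert (t, h) R))) \<le> real (card (ext R)) / (real edges - real N)"
proof -
  have "(real edges - real N) * real (card (ext (insert (t, h) R)))
      \<le> real (edges - card R) * real (card (ext (insert (t, h) R)))"
    using N by (intro mult_right_mono) auto
  also have "\<dots> \<le> real (card (ext R))"
    using card_ext_insert[OF assms(1-4)] by (metis of_nat_le_iff of_nat_mult)
  finally show ?thesis
    using N by (simp add: field_simps)
qed

text \<open>A walk from outside \<open>A\<close> can only enter \<open>A\<close> through a head that has not been revealed before, and
  each time a tail is revealed this has conditional probability at most
  \<open>card {h \<in> heads. fst h \<in> A - B} / (edges - N)\<close> (entering \<open>B\<close> is useless for \<open>W\<close>). From then on the
  trivial bound \<open>W \<le> 1\<close> suffices. The factor \<open>g\<close> is only known through its conditional means.\<close>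

lemma sum_ext_hitting_le:
  fixes W :: "nat \<Rightarrow> (nat \<times> nat \<Rightarrow> nat \<times> nat) \<Rightarrow> nat \<Rightarrow> real"
    and g :: "(nat \<times> nat \<Rightarrow> nat \<times> nat) \<Rightarrow> real" and c :: real
  assumes W0: "\<And>\<sigma> u. u \<notin> A \<Longrightarrow> W 0 \<sigma> u = 0"
    and W_step: "\<And>k \<sigma> u. u \<notin> A \<Longrightarrow> W (Suc k) \<sigma> u \<le> step dp \<sigma> (W k \<sigma>) u"
    and W_nonneg: "\<And>k \<sigma> u. 0 \<le> W k \<sigma> u"
    and W_le_1: "\<And>k \<sigma> u. W k \<sigma> u \<le> 1"
    and W_killed: "\<And>k \<sigma> u. u \<in> B \<Longrightarrow> W k \<sigma> u = 0"
    and g_nonneg: "\<And>\<sigma>. 0 \<le> g \<sigma>"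
    and g_mean: "\<And>R. R \<subseteq> tails \<times> heads \<Longrightarrow> card R \<le> N \<Longrightarrow> sum g (ext R) \<le> c * card (ext R)"
    and N: "N < edges" and c: "0 \<le> c"
    and \<delta>: "real (card {h \<in> heads. fst h \<in> A - B}) / (real edges - real N) \<le> \<delta>"
  shows "R \<subseteq> tails \<times> heads \<Longrightarrow> card R + k \<le> N \<Longrightarrow>
    (\<And>t h. (t, h) \<in> R \<Longrightarrow> fst t \<notin> A \<Longrightarrow> fst h \<notin> A) \<Longrightarrow> u \<in> {1..n} \<Longrightarrow> u \<notin> A \<Longrightarrow>
    (\<Sum>\<sigma>\<in>ext R. W k \<sigma> u * g \<sigma>) \<le> c * (real k * \<delta>) * card (ext R)"
proof (induction k arbitrary: R u)
  case 0
  then show ?case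
    using W0 by simp
next
  case (Suc k)
  let ?D = "{h \<in> heads. fst h \<in> A - B}"
  have \<delta>0: "0 \<le> \<delta>"
    using \<delta> N by (smt (verit) divide_nonneg_nonneg of_nat_0_le_iff of_nat_less_iff)
  have main: "(\<Sum>\<sigma>\<in>ext R. W k \<sigma> (fst (\<sigma> (u, i))) * g \<sigma>) \<le> c * (real (Suc k) * \<delta>) * card (ext R)"
    if i: "i < dp u" for i
  \<comment> \<open>A tail that is already revealed leads to a vertex outside \<open>A\<close>, by
    the invariant on \<open>R\<close>; this step carries no risk of entering \<open>A\<close>, and
    no new edge is used.\<close>
  proof (cases "(u, i) \<in> Domain R")
    case True
    then obtain h where h: "((u, i), h) \<in> R"
      by blast
    then have hA: "fst h \<notin> A" "fst h \<in> {1..n}"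
      using Suc.prems by (force simp: half_edges_def)+
    have "(\<Sum>\<sigma>\<in>ext R. W k \<sigma> (fst (\<sigma> (u, i))) * g \<sigma>) = (\<Sum>\<sigma>\<in>ext R. W k \<sigma> (fst h) * g \<sigma>)"
      using h by (intro sum.cong) (auto simp: ext_def)
    also have "\<dots> \<le> c * (real k * \<delta>) * card (ext R)"
      using Suc.prems hA by (intro Suc.IH) auto
    also have "\<dots> \<le> c * (real (Suc k) * \<delta>) * card (ext R)"
      using c \<delta>0 by (intro mult_right_mono mult_left_mono) auto
    finally show ?thesis .
  next
    case False
    have t: "(u, i) \<in> tails"
      using i Suc.prems by (auto simp: half_edges_def)
    let ?R = "\<lambda>h. insert ((u, i), h) R"
    let ?x = "c * (real k * \<delta>)"
    have finR: "finite R"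
      using Suc.prems(1) by (rule finite_subset) simp
    \<comment> \<open>The first term pays for entering \<open>A - B\<close> through \<open>h\<close>
      now, the second for entering later, by the induction hypothesis. Summed over \<open>h\<close>,
      the second terms recombine to a multiple of \<open>card (ext R)\<close>.\<close>
    have bound: "(\<Sum>\<sigma>\<in>ext (?R h). W k \<sigma> (fst (\<sigma> (u, i))) * g \<sigma>)
        \<le> (if h \<in> ?D then c * (real (card (ext R)) / (real edges - real N)) else 0)
          + ?x * card (ext (?R h))"
      (is "?l \<le> _") if h: "h \<in> heads" for h
    proof -
      have l: "?l = (\<Sum>\<sigma>\<in>ext (?R h). W k \<sigma> (fst h) * g \<sigma>)"
        by (intro sum.cong) (auto simp: ext_def)
      have R: "?R h \<subseteq> tails \<times> heads" "card (?R h) + k \<le> N"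
        using Suc.prems t h finR by (auto simp: card_insert_if)
      have x0: "0 \<le> ?x * card (ext (?R h))"
        using c \<delta>0 by simp
      consider "fst h \<in> B" | "fst h \<in> A - B" | "fst h \<notin> A" "fst h \<notin> B"
        by blast
      then show ?thesis
      proof cases
        case 1
        then show ?thesis
          using l x0 W_killed by simp
      next
        case 2
        have "?l \<le> sum g (ext (?R h))"
          unfolding l using W_le_1 g_nonneg by (intro sum_mono) (simp add: mult_left_le_one_le W_nonneg)
        also have "\<dots> \<le> c * card (ext (?R h))"
          using R by (intro g_mean) auto
        also have "\<dots> \<le> c * (real (card (ext R)) / (real edges - real N))"
          using Suc.prems t h False N c by (intro mult_left_mono card_ext_insert_real) auto
        finally show ?thesis
          using 2 h x0 by simp
      next
        case 3
        have "fst h \<in> {1..n}"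
          using h by (auto simp: half_edges_def)
        \<comment> \<open>The new edge ends outside \<open>A\<close>, so the invariant
          survives.\<close>
        moreover have "fst h' \<notin> A" if "(s, h') \<in> ?R h" "fst s \<notin> A" for s h'
          using that 3 Suc.prems(3)[of s h'] by auto
        ultimately have "?l \<le> ?x * card (ext (?R h))"
          unfolding l using 3 R by (intro Suc.IH) auto
        then show ?thesis
          using 3 by simp
      qed
    qed
    have "(\<Sum>\<sigma>\<in>ext R. W k \<sigma> (fst (\<sigma> (u, i))) * g \<sigma>)
        = (\<Sum>h\<in>heads. \<Sum>\<sigma>\<in>ext (?R h). W k \<sigma> (fst (\<sigma> (u, i))) * g \<sigma>)"
      by (rule sum_ext_reveal[OF t])
    also have "\<dots> \<le> (\<Sum>h\<in>heads. (if h \<in> ?D then c * (real (card (ext R)) / (real edges - real N)) else 0)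
          + ?x * card (ext (?R h)))"
      by (intro sum_mono bound)
    also have "\<dots> = real (card ?D) * (c * (real (card (ext R)) / (real edges - real N)))
          + ?x * card (ext R)"
    proof -
      have "(\<Sum>h\<in>heads. if h \<in> ?D then c * (real (card (ext R)) / (real edges - real N)) else 0)
          = (\<Sum>h\<in>heads \<inter> ?D. c * (real (card (ext R)) / (real edges - real N)))"
        by (subst sum.inter_restrict) auto
      moreover have "heads \<inter> ?D = ?D"
        by blast
      ultimately show ?thesis
        using card_ext_reveal[OF t, of R]
        by (simp add: sum.distrib sum_distrib_left[symmetric] del: mem_Collect_eq)
    qed
    also have "\<dots> = c * (real (card ?D) / (real edges - real N)) * card (ext R) + ?x * card (ext R)"
      by simp
    also have "\<dots> \<le> c * \<delta> * card (ext R) + ?x * card (ext R)"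
      using c \<delta> by (intro add_right_mono mult_right_mono mult_left_mono) auto
    also have "\<dots> = c * (real (Suc k) * \<delta>) * card (ext R)"
      by (simp add: algebra_simps)
    finally show ?thesis .
  qed
  have "(\<Sum>\<sigma>\<in>ext R. W (Suc k) \<sigma> u * g \<sigma>) \<le> (\<Sum>\<sigma>\<in>ext R. step dp \<sigma> (W k \<sigma>) u * g \<sigma>)"
    using W_step Suc.prems g_nonneg by (intro sum_mono mult_right_mono) auto
  also have "\<dots> = (\<Sum>i<dp u. \<Sum>\<sigma>\<in>ext R. W k \<sigma> (fst (\<sigma> (u, i))) * g \<sigma>) / real (dp u)"
    by (subst sum.swap) (simp add: step_def sum_distrib_right sum_divide_distrib)
  also have "\<dots> \<le> (\<Sum>i<dp u. c * (real (Suc k) * \<delta>) * card (ext R)) / real (dp u)"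
    by (intro divide_right_mono sum_mono main) auto
  also have "\<dots> \<le> c * (real (Suc k) * \<delta>) * card (ext R)"
    using c \<delta>0 by (cases "dp u = 0") auto
  finally show ?case .
qed

end

section \<open>Moments of truncated PageRank\<close>

context configuration_model
begin

text \<open>For \<open>a k = \<alpha> * (1 - \<alpha>) ^ k\<close>, \<open>l\<close> the teleporting
  distribution and \<open>B = {}\<close>, these are the first \<open>L\<close> terms of the PageRank
  series at \<open>v\<close>.\<close>

definition truncated_rank ::
    "(nat \<Rightarrow> real) \<Rightarrow> (nat \<Rightarrow> real) \<Rightarrow> nat \<Rightarrow> nat set \<Rightarrow> nat \<Rightarrow> (nat \<times> nat \<Rightarrow> nat \<times> nat) \<Rightarrow> real" where
  "truncated_rank a l L B v \<sigma> = (\<Sum>k<L. a k * (\<Sum>u\<in>{1..n}. l u * walk dp \<sigma> B v k u))"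

context
  fixes a l :: "nat \<Rightarrow> real" and L :: nat and \<Lambda> :: real
  assumes a_nonneg: "\<And>k. 0 \<le> a k" and a_sum: "(\<Sum>k<L. a k) \<le> 1"
    and l_nonneg: "\<And>u. 0 \<le> l u" and l_sum: "(\<Sum>u\<in>{1..n}. l u) \<le> 1"
    and l_le: "\<And>u. u \<in> {1..n} \<Longrightarrow> l u \<le> \<Lambda>"
begin

lemma truncated_rank_nonneg: "0 \<le> truncated_rank a l L B v \<sigma>"
  unfolding truncated_rank_def
  by (intro sum_nonneg mult_nonneg_nonneg a_nonneg l_nonneg walk_nonneg)

text \<open>Expanding one factor into walks, each walk reveals at most \<open>L\<close> edges, and it ends at \<open>v\<close> only if
  it enters the set of \<open>v\<close> and the at most \<open>2 * N\<close> vertices revealed before. Hence the factors can be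
  integrated one after the other.\<close>

lemma truncated_rank_moment:
  fixes D :: real
  assumes N: "N < edges" and D: "\<And>w. w \<in> {1..n} - B \<Longrightarrow> real (dm w) \<le> D" "0 \<le> D"
    and \<Lambda>: "0 \<le> \<Lambda>" and v: "v \<in> {1..n}"
    and \<beta>: "(1 + 2 * real N) * (\<Lambda> + real L * (D / (real edges - real N))) \<le> \<beta>"
  shows "R \<subseteq> tails \<times> heads \<Longrightarrow> card R + j * L \<le> N \<Longrightarrow>
    (\<Sum>\<sigma>\<in>ext R. truncated_rank a l L B v \<sigma> ^ j) \<le> \<beta> ^ j * card (ext R)"
proof (induction j arbitrary: R)
  case 0
  then show ?case
    by simp
next
  case (Suc j)
  let ?q = "truncated_rank a l L B v"
  let ?c = "\<beta> ^ j"
  define \<delta> where "\<delta> = (1 + 2 * real N) * (D / (real edges - real N))"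
  \<comment> \<open>All endpoints of revealed edges belong to \<open>A\<close>, so no revealed tail
    sits outside \<open>A\<close> and the invariant of \<open>sum_ext_hitting_le\<close> holds at
    the start.\<close>
  define A where "A = insert v (fst ` Domain R \<union> fst ` Range R)"
  have \<delta>0: "0 \<le> \<delta>"
    using N D by (simp add: \<delta>_def)
  have "0 \<le> (1 + 2 * real N) * (\<Lambda> + real L * (D / (real edges - real N)))"
    using N D \<Lambda> by simp
  then have \<beta>0: "0 \<le> \<beta>"
    using \<beta> by linarith
  then have c0: "0 \<le> ?c"
    by simp
  have finR: "finite R"
    using Suc.prems(1) by (rule finite_subset) simp
  then have finA: "finite A"
    by (simp add: A_def finite_Domain finite_Range)
  have AV: "A \<subseteq> {1..n}"
    using Suc.prems(1) v by (force simp: A_def half_edges_def)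
  have "card A \<le> Suc (card (fst ` Domain R \<union> fst ` Range R))"
    unfolding A_def by (rule card_insert_le_m1) auto
  also have "card (fst ` Domain R \<union> fst ` Range R) \<le> card (fst ` Domain R) + card (fst ` Range R)"
    by (rule card_Un_le)
  also have "\<dots> \<le> card (Domain R) + card (Range R)"
    using finR by (intro add_mono card_image_le finite_Domain finite_Range)
  also have "\<dots> \<le> card R + card R"
    using finR by (intro add_mono) (simp_all add: Domain_fst Range_snd card_image_le)
  finally have cardA: "real (card A) \<le> 1 + 2 * real N"
    using Suc.prems(2) by (simp add: le_diff_conv)
  \<comment> \<open>The first walk may use edges up to \<open>N - j * L\<close>; the remaining
    \<open>j * L\<close> are reserved for the other \<open>j\<close> factors.\<close>
  have IH: "sum (\<lambda>\<sigma>. ?q \<sigma> ^ j) (ext R') \<le> ?c * card (ext R')"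
    if "R' \<subseteq> tails \<times> heads" "card R' \<le> N - j * L" for R'
    using that Suc.prems by (intro Suc.IH) auto
  have "card {h \<in> heads. fst h \<in> A - B} = (\<Sum>w\<in>A - B. dm w)"
    using AV by (intro card_half_edges_vertices) auto
  then have "real (card {h \<in> heads. fst h \<in> A - B}) = (\<Sum>w\<in>A - B. real (dm w))"
    by simp
  also have "\<dots> \<le> (\<Sum>w\<in>A - B. D)"
    using AV D by (intro sum_mono) auto
  also have "\<dots> \<le> real (card A) * D"
    using finA D by (simp add: card_mono mult_right_mono)
  also have "\<dots> \<le> (1 + 2 * real N) * D"
    using cardA D by (intro mult_right_mono)
  finally have hA: "real (card {h \<in> heads. fst h \<in> A - B}) \<le> (1 + 2 * real N) * D" .
  have \<delta>: "real (card {h \<in> heads. fst h \<in> A - B}) / (real edges - real (N - j * L)) \<le> \<delta>"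
  proof -
    have "real (card {h \<in> heads. fst h \<in> A - B}) / (real edges - real (N - j * L))
        \<le> ((1 + 2 * real N) * D) / (real edges - real N)"
      using hA N D by (intro frac_le) auto
    then show ?thesis
      by (simp add: \<delta>_def)
  qed
  \<comment> \<open>A walk from outside \<open>A\<close> must enter \<open>A\<close> to reach
    \<open>v\<close>. The other \<open>j\<close> factors play the role of \<open>g\<close>.\<close>
  have outside: "(\<Sum>\<sigma>\<in>ext R. walk dp \<sigma> B v k u * ?q \<sigma> ^ j) \<le> ?c * (real k * \<delta>) * card (ext R)"
    if k: "k < L" and u: "u \<in> {1..n}" "u \<notin> A" for k u
  proof (rule sum_ext_hitting_le[where N = "N - j * L" and A = A and B = B
        and W = "\<lambda>k \<sigma>. walk dp \<sigma> B v k"])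
    fix \<sigma> k u assume "u \<notin> A"
    then show "walk dp \<sigma> B v 0 u = 0"
      by (auto simp: A_def)
    show "walk dp \<sigma> B v (Suc k) u \<le> step dp \<sigma> (walk dp \<sigma> B v k) u"
      by (auto intro: step_nonneg walk_nonneg)
  next
    fix t h assume "(t, h) \<in> R" "fst t \<notin> A"
    then show "fst h \<notin> A"
      by (force simp: A_def)
  next
    show "card R + k \<le> N - j * L"
      using Suc.prems k by auto
  next
    show "N - j * L < edges"
      using N by simp
  qed (use IH c0 \<delta> Suc.prems u truncated_rank_nonneg in
      \<open>auto simp: walk_nonneg walk_le_1 walk_killed\<close>)
  \<comment> \<open>Starting points in \<open>A\<close> get the trivial bound 1. There are at most
    \<open>1 + 2 * N\<close> of them, each of weight at most \<open>\<Lambda>\<close>, which gives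
    the first part of \<open>\<beta>\<close>.\<close>
  have inside: "(\<Sum>\<sigma>\<in>ext R. walk dp \<sigma> B v k u * ?q \<sigma> ^ j) \<le> ?c * card (ext R)" for k u
  proof -
    have "(\<Sum>\<sigma>\<in>ext R. walk dp \<sigma> B v k u * ?q \<sigma> ^ j) \<le> (\<Sum>\<sigma>\<in>ext R. ?q \<sigma> ^ j)"
      by (intro sum_mono mult_left_le_one_le zero_le_power truncated_rank_nonneg walk_nonneg walk_le_1)
    also have "\<dots> \<le> ?c * card (ext R)"
      using Suc.prems by (intro IH) auto
    finally show ?thesis .
  qed
  have k_bound: "(\<Sum>u\<in>{1..n}. l u * (\<Sum>\<sigma>\<in>ext R. walk dp \<sigma> B v k u * ?q \<sigma> ^ j))
      \<le> \<beta> * (?c * card (ext R))" if k: "k < L" for k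
  proof -
    let ?E = "?c * card (ext R)"
    have E0: "0 \<le> ?E"
      using c0 by simp
    have "(\<Sum>u\<in>{1..n}. l u * (\<Sum>\<sigma>\<in>ext R. walk dp \<sigma> B v k u * ?q \<sigma> ^ j))
        \<le> (\<Sum>u\<in>{1..n}. l u * (real L * \<delta>) * ?E + (if u \<in> A then \<Lambda> * ?E else 0))"
    proof (rule sum_mono)
      fix u assume u: "u \<in> {1..n}"
      show "l u * (\<Sum>\<sigma>\<in>ext R. walk dp \<sigma> B v k u * ?q \<sigma> ^ j)
        \<le> l u * (real L * \<delta>) * ?E + (if u \<in> A then \<Lambda> * ?E else 0)"
      proof (cases "u \<in> A")
        case True
        have "l u * (\<Sum>\<sigma>\<in>ext R. walk dp \<sigma> B v k u * ?q \<sigma> ^ j) \<le> \<Lambda> * ?E"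
          using inside[of k u] l_le[OF u] l_nonneg[of u] E0 \<Lambda>
          by (meson mult_left_mono mult_right_mono order_trans)
        moreover have "0 \<le> l u * (real L * \<delta>) * ?E"
          by (intro \<delta>0 E0 mult_nonneg_nonneg l_nonneg of_nat_0_le_iff)
        ultimately show ?thesis
          using True by simp
      next
        case False
        have "(\<Sum>\<sigma>\<in>ext R. walk dp \<sigma> B v k u * ?q \<sigma> ^ j) \<le> real k * \<delta> * ?E"
          using outside[OF k u False] by (simp add: mult_ac)
        also have "\<dots> \<le> real L * \<delta> * ?E"
          using k \<delta>0 E0 by (intro mult_right_mono) auto
        finally have "l u * (\<Sum>\<sigma>\<in>ext R. walk dp \<sigma> B v k u * ?q \<sigma> ^ j) \<le> l u * (real L * \<delta> * ?E)"
          by (rule mult_left_mono[OF _ l_nonneg])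
        also have "\<dots> = l u * (real L * \<delta>) * ?E"
          by (simp only: mult.assoc)
        finally show ?thesis
          using False by (simp only: if_False add_0_right)
      qed
    qed
    also have "\<dots> = (\<Sum>u\<in>{1..n}. l u) * (real L * \<delta> * ?E) + real (card A) * (\<Lambda> * ?E)"
      using AV by (simp add: sum.distrib sum.If_cases sum_distrib_right mult.assoc Int_absorb1)
    also have "\<dots> \<le> 1 * (real L * \<delta> * ?E) + (1 + 2 * real N) * (\<Lambda> * ?E)"
      using l_sum cardA \<Lambda> E0 \<delta>0 by (intro add_mono mult_right_mono) auto
    also have "\<dots> = ((1 + 2 * real N) * (\<Lambda> + real L * (D / (real edges - real N)))) * ?E"
      by (simp add: algebra_simps \<delta>_def)
    also have "\<dots> \<le> \<beta> * ?E"
      by (rule mult_right_mono[OF \<beta> E0])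
    finally show ?thesis .
  qed
  have "(\<Sum>\<sigma>\<in>ext R. ?q \<sigma> ^ Suc j)
      = (\<Sum>\<sigma>\<in>ext R. \<Sum>k<L. \<Sum>u\<in>{1..n}. a k * (l u * (walk dp \<sigma> B v k u * ?q \<sigma> ^ j)))"
    unfolding power_Suc
    by (subst (1) truncated_rank_def)
      (simp add: sum_distrib_left sum_distrib_right mult.assoc)
  also have "\<dots> = (\<Sum>k<L. a k * (\<Sum>u\<in>{1..n}. l u * (\<Sum>\<sigma>\<in>ext R. walk dp \<sigma> B v k u * ?q \<sigma> ^ j)))"
    by (subst sum.swap, rule sum.cong[OF refl], subst sum.swap) (simp add: sum_distrib_left)
  also have "\<dots> \<le> (\<Sum>k<L. a k * (\<beta> * (?c * card (ext R))))"
    by (intro sum_mono mult_left_mono k_bound a_nonneg) auto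
  also have "\<dots> = (\<Sum>k<L. a k) * (\<beta> * (?c * card (ext R)))"
    by (simp add: sum_distrib_right)
  also have "\<dots> \<le> 1 * (\<beta> * (?c * card (ext R)))"
    using a_sum \<beta>0 by (intro mult_right_mono) auto
  finally show ?case
    by (simp add: mult_ac)
qed

text \<open>A walk meets \<open>B\<close> either because it starts there, which has probability at
  most \<open>card B * \<Lambda>\<close>, or because one of fewer than \<open>L\<close> steps enters
  it through a fresh head. The exposure bound applies with \<open>A = B\<close>, no killing and
  \<open>g = 1\<close>.\<close>

lemma truncated_rank_through_mean:
  assumes L: "L < edges" and B: "B \<subseteq> {1..n}"
    and \<beta>: "real (card B) * \<Lambda> + real L * (real (\<Sum>w\<in>B. dm w) / (real edges - real L)) \<le> \<beta>"
  shows "(\<Sum>\<sigma>\<in>matchings n dm dp. \<Sum>v\<in>{1..n}. truncated_rank a l L {} v \<sigma> - truncated_rank a l L B v \<sigma>)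
    \<le> \<beta> * card (matchings n dm dp)"
proof -
  let ?M = "matchings n dm dp"
  define \<delta> where "\<delta> = real (\<Sum>w\<in>B. dm w) / (real edges - real L)"
  have \<delta>0: "0 \<le> \<delta>"
    using L unfolding \<delta>_def by (intro divide_nonneg_nonneg) (auto intro: sum_nonneg)
  have u_bound: "l u * (\<Sum>\<sigma>\<in>?M. hit dp \<sigma> B k u)
      \<le> l u * (real L * \<delta> * card ?M) + (if u \<in> B then \<Lambda> * card ?M else 0)"
    if k: "k < L" and u: "u \<in> {1..n}" for k u
  proof (cases "u \<in> B")
    case True
    have "l u * (\<Sum>\<sigma>\<in>?M. hit dp \<sigma> B k u) \<le> l u * card ?M"
      using sum_mono[of ?M "\<lambda>\<sigma>. hit dp \<sigma> B k u" "\<lambda>_. 1"] hit_le_1 l_nonneg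
      by (intro mult_left_mono) auto
    also have "\<dots> \<le> \<Lambda> * card ?M"
      using l_le[OF u] by (intro mult_right_mono) auto
    moreover have "0 \<le> l u * (real L * \<delta> * card ?M)"
      using l_nonneg \<delta>0 by simp
    ultimately show ?thesis
      using True by simp
  next
    case False
    have "(\<Sum>\<sigma>\<in>ext {}. hit dp \<sigma> B k u * 1) \<le> 1 * (real k * \<delta>) * card (ext {})"
    proof (rule sum_ext_hitting_le[where N = L and A = B and B = "{}" and W = "\<lambda>k \<sigma>. hit dp \<sigma> B k"])
      have "card {h \<in> heads. fst h \<in> B - {}} = (\<Sum>w\<in>B. dm w)"
        using card_half_edges_vertices[OF B, of dm] by simp
      then show "real (card {h \<in> heads. fst h \<in> B - {}}) / (real edges - real L) \<le> \<delta>"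
        by (simp add: \<delta>_def)
    qed (use L u False k in \<open>auto simp: hit_nonneg hit_le_1\<close>)
    also have "\<dots> \<le> real L * \<delta> * card ?M"
      using k \<delta>0 by (auto intro!: mult_right_mono simp del: times_divide_eq_right)
    finally show ?thesis
      using False l_nonneg by (simp add: mult_left_mono)
  qed
  have k_bound: "(\<Sum>u\<in>{1..n}. l u * (\<Sum>\<sigma>\<in>?M. hit dp \<sigma> B k u)) \<le> \<beta> * card ?M" if k: "k < L" for k
  proof -
    have "(\<Sum>u\<in>{1..n}. l u * (\<Sum>\<sigma>\<in>?M. hit dp \<sigma> B k u))
        \<le> (\<Sum>u\<in>{1..n}. l u * (real L * \<delta> * card ?M) + (if u \<in> B then \<Lambda> * card ?M else 0))"
      using k by (intro sum_mono u_bound)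
    also have "\<dots> = (\<Sum>u\<in>{1..n}. l u) * (real L * \<delta> * card ?M) + real (card B) * (\<Lambda> * card ?M)"
      using B by (simp add: sum.distrib sum.If_cases sum_distrib_right Int_absorb1)
    also have "\<dots> \<le> 1 * (real L * \<delta> * card ?M) + real (card B) * (\<Lambda> * card ?M)"
      using l_sum \<delta>0 by (intro add_right_mono mult_right_mono) auto
    also have "\<dots> = (real (card B) * \<Lambda> + real L * \<delta>) * card ?M"
      by (simp add: algebra_simps)
    also have "\<dots> \<le> \<beta> * card ?M"
      using \<beta> by (intro mult_right_mono) (auto simp: \<delta>_def)
    finally show ?thesis .
  qed
  \<comment> \<open>The sign of \<open>\<beta>\<close> is read off from the quantities it bounds; it
    is used at the end, when the sum of the weights \<open>a\<close> is replaced by 1.\<close>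
  have "0 \<le> \<beta>" if "0 < L"
  proof -
    have "0 \<le> (\<Sum>u\<in>{1..n}. l u * (\<Sum>\<sigma>\<in>?M. hit dp \<sigma> B 0 u))"
      by (intro sum_nonneg mult_nonneg_nonneg l_nonneg hit_nonneg)
    also have "\<dots> \<le> \<beta> * card ?M"
      by (rule k_bound[OF that])
    finally show ?thesis
      using matchings_nonempty by (simp add: zero_le_mult_iff card_gt_0_iff)
  qed
  moreover have "0 \<le> \<beta>" if "L = 0"
  proof (cases "B = {}")
    case True
    then show ?thesis
      using \<beta> that by simp
  next
    case False
    then obtain w where "w \<in> {1..n}"
      using B by blast
    then have "0 \<le> \<Lambda>"
      using l_le l_nonneg order_trans by blast
    then have "0 \<le> real (card B) * \<Lambda>"
      by simp
    then show ?thesis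
      using \<beta> that by simp
  qed
  ultimately have \<beta>0: "0 \<le> \<beta>"
    by blast
  have "(\<Sum>v\<in>{1..n}. truncated_rank a l L {} v \<sigma> - truncated_rank a l L B v \<sigma>)
      = (\<Sum>k<L. a k * (\<Sum>u\<in>{1..n}. l u * (\<Sum>v\<in>{1..n}. walk dp \<sigma> {} v k u - walk dp \<sigma> B v k u)))"
    (is "?lhs \<sigma> = _") for \<sigma>
  proof -
    have "?lhs \<sigma> = (\<Sum>v\<in>{1..n}. \<Sum>k<L. \<Sum>u\<in>{1..n}.
        a k * (l u * (walk dp \<sigma> {} v k u - walk dp \<sigma> B v k u)))"
      unfolding truncated_rank_def
      by (simp only: sum_subtractf[symmetric] right_diff_distrib[symmetric] sum_distrib_left)
    also have "\<dots> = (\<Sum>k<L. \<Sum>u\<in>{1..n}. \<Sum>v\<in>{1..n}.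
        a k * (l u * (walk dp \<sigma> {} v k u - walk dp \<sigma> B v k u)))"
      by (subst sum.swap, rule sum.cong[OF refl], rule sum.swap)
    finally show ?thesis
      by (simp only: sum_distrib_left)
  qed
  then have "?lhs \<sigma> \<le> (\<Sum>k<L. a k * (\<Sum>u\<in>{1..n}. l u * hit dp \<sigma> B k u))" for \<sigma>
    by (simp add: sum_mono mult_left_mono a_nonneg l_nonneg sum_walk_through_le_hit)
  then have "(\<Sum>\<sigma>\<in>?M. ?lhs \<sigma>) \<le> (\<Sum>\<sigma>\<in>?M. \<Sum>k<L. a k * (\<Sum>u\<in>{1..n}. l u * hit dp \<sigma> B k u))"
    by (intro sum_mono)
  also have "\<dots> = (\<Sum>k<L. a k * (\<Sum>u\<in>{1..n}. l u * (\<Sum>\<sigma>\<in>?M. hit dp \<sigma> B k u)))"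
    unfolding sum_distrib_left
    by (subst sum.swap, rule sum.cong[OF refl], rule sum.swap)
  also have "\<dots> \<le> (\<Sum>k<L. a k * (\<beta> * card ?M))"
    by (intro sum_mono mult_left_mono k_bound a_nonneg) auto
  also have "\<dots> = (\<Sum>k<L. a k) * (\<beta> * card ?M)"
    by (simp add: sum_distrib_right)
  also have "\<dots> \<le> 1 * (\<beta> * card ?M)"
    using a_sum \<beta>0 by (intro mult_right_mono) auto
  finally show ?thesis
    by simp
qed

end

end

section \<open>PageRank as a sum over walks\<close>

lemma pmf_bind_finite:
  assumes "finite V" "set_pmf p \<subseteq> V"
  shows "pmf (bind_pmf p f) y = (\<Sum>x\<in>V. pmf p x * pmf (f x) y)"
  unfolding pmf_bind using assms by (subst integral_measure_pmf[of V]) auto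

lemma eq_zero_if_abs_le_powers:
  fixes x :: real
  assumes "\<And>L. \<bar>x\<bar> \<le> r ^ L" "0 \<le> r" "r < 1"
  shows "x = 0"
proof -
  have "(\<lambda>L. r ^ L) \<longlonglongrightarrow> 0"
    using assms by (intro LIMSEQ_power_zero) auto
  then have "\<bar>x\<bar> \<le> 0"
    by (rule LIMSEQ_le_const) (use assms in auto)
  then show ?thesis
    by simp
qed

locale pagerank_model = configuration_model +
  fixes \<alpha> :: real and lam :: "nat pmf"
  assumes dp_pos: "\<And>v. v \<in> {1..n} \<Longrightarrow> 0 < dp v"
    and \<alpha>: "0 < \<alpha>" "\<alpha> < 1"
    and lam: "set_pmf lam \<subseteq> {1..n}"
begin

lemma sum_lam: "(\<Sum>u\<in>{1..n}. pmf lam u) = 1"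
  using lam by (intro sum_pmf_eq_1) auto

abbreviation srw :: "(nat \<times> nat \<Rightarrow> nat \<times> nat) \<Rightarrow> nat \<Rightarrow> nat \<Rightarrow> real" where
  "srw \<sigma> \<equiv> srw_matrix dp (graph_of_matching n dp \<sigma>)"

abbreviation rank :: "(nat \<times> nat \<Rightarrow> nat \<times> nat) \<Rightarrow> nat \<Rightarrow> real" where
  "rank \<sigma> v \<equiv> pmf (pagerank n \<alpha> lam (srw \<sigma>)) v"

abbreviation partial_rank :: "nat \<Rightarrow> nat set \<Rightarrow> nat \<Rightarrow> (nat \<times> nat \<Rightarrow> nat \<times> nat) \<Rightarrow> real" where
  "partial_rank \<equiv> truncated_rank (\<lambda>k. \<alpha> * (1 - \<alpha>) ^ k) (pmf lam)"

lemma srw_eq: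
  assumes "u \<in> {1..n}"
  shows "srw \<sigma> u x = (\<Sum>i<dp u. of_bool (fst (\<sigma> (u, i)) = x)) / real (dp u)"
proof -
  have eq: "{t \<in> tails. fst t = u \<and> fst (\<sigma> t) = x} = Pair u ` {i. i < dp u \<and> fst (\<sigma> (u, i)) = x}"
    using assms by (auto simp: half_edges_def)
  have "count (graph_of_matching n dp \<sigma>) (u, x) = card {t \<in> tails. fst t = u \<and> fst (\<sigma> t) = x}"
    unfolding graph_of_matching_def by (simp add: count_image_mset vimage_def Int_def conj_commute)
  also have "\<dots> = card {i. i < dp u \<and> fst (\<sigma> (u, i)) = x}"
    unfolding eq by (intro card_image) (auto simp: inj_on_def)
  finally show ?thesis
    by (simp add: srw_matrix_def of_bool_def sum.If_cases Int_def)
qed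

text \<open>Edge multiplicities regroup the tails of \<open>u\<close> by the vertex they point to;
  this links the matrix of the multigraph to \<open>step\<close>. That \<open>\<sigma>\<close> is a
  matching keeps all these vertices in \<open>{1..n}\<close>.\<close>

lemma sum_srw:
  assumes \<sigma>: "\<sigma> \<in> matchings n dm dp" and u: "u \<in> {1..n}"
  shows "(\<Sum>x\<in>{1..n}. srw \<sigma> u x * f x) = step dp \<sigma> f u"
proof -
  have "(\<Sum>x\<in>{1..n}. of_bool (fst (\<sigma> (u, i)) = x) * f x) = f (fst (\<sigma> (u, i)))" if "i < dp u" for i
  proof -
    have "(u, i) \<in> tails"
      using that u by (simp add: half_edges_def)
    then have "fst (\<sigma> (u, i)) \<in> {1..n}"
      using matching_in_heads[OF \<sigma>] by (force simp: half_edges_def)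
    then show ?thesis
      by (subst sum.remove[of _ "fst (\<sigma> (u, i))"]) auto
  qed
  then have "(\<Sum>i<dp u. \<Sum>x\<in>{1..n}. of_bool (fst (\<sigma> (u, i)) = x) * f x) / real (dp u) = step dp \<sigma> f u"
    by (simp add: step_def)
  moreover have "(\<Sum>x\<in>{1..n}. srw \<sigma> u x * f x)
      = (\<Sum>i<dp u. \<Sum>x\<in>{1..n}. of_bool (fst (\<sigma> (u, i)) = x) * f x) / real (dp u)"
    by (subst sum.swap)
      (simp only: srw_eq[OF u] sum_divide_distrib sum_distrib_right times_divide_eq_left)
  ultimately show ?thesis
    by simp
qed

abbreviation stationary :: "(nat \<times> nat \<Rightarrow> nat \<times> nat) \<Rightarrow> nat pmf \<Rightarrow> bool" where
  "stationary \<sigma> \<equiv> stationary_distribution {1..n} (pagerank_matrix \<alpha> lam (srw \<sigma>))"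

text \<open>Stationarity tested against \<open>f\<close>: the dual form, in which the operator
  \<open>step\<close> acts on \<open>f\<close> and can be iterated.\<close>

lemma stationary_sum:
  assumes \<sigma>: "\<sigma> \<in> matchings n dm dp" and \<pi>: "stationary \<sigma> \<pi>"
  shows "(\<Sum>v\<in>{1..n}. pmf \<pi> v * f v) =
    \<alpha> * (\<Sum>u\<in>{1..n}. pmf lam u * f u) + (1 - \<alpha>) * (\<Sum>u\<in>{1..n}. pmf \<pi> u * step dp \<sigma> f u)"
proof -
  have one: "(\<Sum>u\<in>{1..n}. pmf \<pi> u) = 1"
    using \<pi> by (intro sum_pmf_eq_1) (auto simp: stationary_distribution_def)
  have "(\<Sum>v\<in>{1..n}. pmf \<pi> v * f v)
      = (\<Sum>v\<in>{1..n}. (\<Sum>u\<in>{1..n}. pmf \<pi> u * ((1 - \<alpha>) * srw \<sigma> u v + \<alpha> * pmf lam v)) * f v)"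
    using \<pi> by (intro sum.cong) (auto simp: stationary_distribution_def pagerank_matrix_def)
  also have "\<dots> = (\<Sum>v\<in>{1..n}. \<Sum>u\<in>{1..n}. pmf \<pi> u * ((1 - \<alpha>) * (srw \<sigma> u v * f v)))
      + (\<Sum>v\<in>{1..n}. \<Sum>u\<in>{1..n}. pmf \<pi> u * (\<alpha> * (pmf lam v * f v)))"
    by (simp only: sum.distrib[symmetric] sum_distrib_right) (simp add: algebra_simps)
  also have "(\<Sum>v\<in>{1..n}. \<Sum>u\<in>{1..n}. pmf \<pi> u * (\<alpha> * (pmf lam v * f v)))
      = \<alpha> * (\<Sum>v\<in>{1..n}. pmf lam v * f v)"
    by (simp only: sum_distrib_right[symmetric] one) (simp add: sum_distrib_left)
  also have "(\<Sum>v\<in>{1..n}. \<Sum>u\<in>{1..n}. pmf \<pi> u * ((1 - \<alpha>) * (srw \<sigma> u v * f v)))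
      = (\<Sum>u\<in>{1..n}. pmf \<pi> u * ((1 - \<alpha>) * (\<Sum>v\<in>{1..n}. srw \<sigma> u v * f v)))"
    by (subst sum.swap) (simp only: sum_distrib_left)
  also have "\<dots> = (1 - \<alpha>) * (\<Sum>u\<in>{1..n}. pmf \<pi> u * step dp \<sigma> f u)"
    using sum_srw[OF \<sigma>] by (simp add: sum_distrib_left mult_ac)
  finally show ?thesis
    by simp
qed

text \<open>Without killing, \<open>walk\<close> at time \<open>Suc L\<close> is \<open>step\<close>
  applied to \<open>walk\<close> at time \<open>L\<close>, so each use of
  \<open>stationary_sum\<close> splits off one more term of the series. The remainder corresponds to
  geometric times at least \<open>L\<close>.\<close>

lemma stationary_expansion:
  assumes \<sigma>: "\<sigma> \<in> matchings n dm dp" and \<pi>: "stationary \<sigma> \<pi>" and v: "v \<in> {1..n}"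
  shows "pmf \<pi> v = partial_rank L {} v \<sigma>
    + (1 - \<alpha>) ^ L * (\<Sum>u\<in>{1..n}. pmf \<pi> u * walk dp \<sigma> {} v L u)"
proof (induction L)
  case 0
  have "(\<Sum>u\<in>{1..n}. pmf \<pi> u * of_bool (u = v)) = pmf \<pi> v"
    using v by (subst sum.remove[of _ v]) auto
  then show ?case
    by (simp add: truncated_rank_def)
next
  case (Suc L)
  then show ?case
    unfolding stationary_sum[OF \<sigma> \<pi>, of "walk dp \<sigma> {} v L"]
    by (simp add: truncated_rank_def distrib_left mult_ac)
qed

lemma stationary_bounds:
  assumes "\<sigma> \<in> matchings n dm dp" "stationary \<sigma> \<pi>" "v \<in> {1..n}"
  shows "partial_rank L {} v \<sigma> \<le> pmf \<pi> v" "pmf \<pi> v \<le> partial_rank L {} v \<sigma> + (1 - \<alpha>) ^ L"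
proof -
  have "(\<Sum>u\<in>{1..n}. pmf \<pi> u * walk dp \<sigma> {} v L u) \<le> (\<Sum>u\<in>{1..n}. pmf \<pi> u)"
    by (intro sum_mono mult_right_le_one_le walk_nonneg walk_le_1) auto
  also have "\<dots> = 1"
    using assms by (intro sum_pmf_eq_1) (auto simp: stationary_distribution_def)
  finally have 1: "(\<Sum>u\<in>{1..n}. pmf \<pi> u * walk dp \<sigma> {} v L u) \<le> 1" .
  have 0: "0 \<le> (\<Sum>u\<in>{1..n}. pmf \<pi> u * walk dp \<sigma> {} v L u)"
    by (intro sum_nonneg mult_nonneg_nonneg walk_nonneg) auto
  show "partial_rank L {} v \<sigma> \<le> pmf \<pi> v"
    using 0 \<alpha> stationary_expansion[OF assms, of L] by simp
  show "pmf \<pi> v \<le> partial_rank L {} v \<sigma> + (1 - \<alpha>) ^ L"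
    using mult_left_mono[OF 1, of "(1 - \<alpha>) ^ L"] \<alpha> stationary_expansion[OF assms, of L] by simp
qed

text \<open>Both candidates lie within \<open>(1 - \<alpha>) ^ L\<close> above the same partial sum,
  which does not depend on the candidate.\<close>

lemma stationary_unique:
  assumes \<sigma>: "\<sigma> \<in> matchings n dm dp" and "stationary \<sigma> \<pi>" "stationary \<sigma> \<pi>'"
  shows "\<pi> = \<pi>'"
proof (rule pmf_eqI)
  fix v
  show "pmf \<pi> v = pmf \<pi>' v"
  proof (cases "v \<in> {1..n}")
    case True
    have "\<bar>pmf \<pi> v - pmf \<pi>' v\<bar> \<le> (1 - \<alpha>) ^ L" for L
      using stationary_bounds[OF \<sigma> assms(2) True, of L] stationary_bounds[OF \<sigma> assms(3) True, of L]
      by linarith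
    then have "pmf \<pi> v - pmf \<pi>' v = 0"
      using \<alpha> by (intro eq_zero_if_abs_le_powers[of _ "1 - \<alpha>"]) auto
    then show ?thesis
      by simp
  next
    case False
    then have "v \<notin> set_pmf \<pi>" "v \<notin> set_pmf \<pi>'"
      using assms by (auto simp: stationary_distribution_def)
    then show ?thesis
      by (simp add: set_pmf_iff)
  qed
qed

text \<open>The stationary distribution is the law of the walk started from \<open>lam\<close> at an independent
  geometric time.\<close>

lemma stationary_exists:
  assumes \<sigma>: "\<sigma> \<in> matchings n dm dp"
  shows "\<exists>\<pi>. stationary \<sigma> \<pi>"
proof -
  define kern where "kern = (\<lambda>u. map_pmf (\<lambda>i. fst (\<sigma> (u, i))) (pmf_of_set {..<dp u}))"
  define law where "law = (\<lambda>k. ((\<lambda>p. bind_pmf p kern) ^^ k) lam)"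
  define \<pi> where "\<pi> = bind_pmf (geometric_pmf \<alpha>) law"
  have kern_set: "set_pmf (kern u) \<subseteq> {1..n}" if "u \<in> {1..n}" for u
  proof -
    have "fst (\<sigma> (u, i)) \<in> {1..n}" if "i < dp u" for i
    proof -
      have "(u, i) \<in> tails"
        using that \<open>u \<in> {1..n}\<close> by (simp add: half_edges_def)
      then show ?thesis
        using matching_in_heads[OF \<sigma>] by (force simp: half_edges_def)
    qed
    moreover have "{..<dp u} \<noteq> {}"
      using dp_pos[OF that] by auto
    ultimately show ?thesis
      by (auto simp: kern_def)
  qed
  have law_set: "set_pmf (law k) \<subseteq> {1..n}" for k
  proof (induction k)
    case 0
    then show ?case
      using lam by (simp add: law_def)
  next
    case (Suc k)
    have "law (Suc k) = bind_pmf (law k) kern"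
      by (simp add: law_def)
    then show ?case
      using Suc kern_set by (simp del: atLeastAtMost_iff) blast
  qed
  then have \<pi>_set: "set_pmf \<pi> \<subseteq> {1..n}"
    by (auto simp: \<pi>_def)
  have kern_pmf: "pmf (kern u) v = srw \<sigma> u v" if "u \<in> {1..n}" for u v
  proof -
    have "{..<dp u} \<inter> (\<lambda>i. fst (\<sigma> (u, i))) -` {v} = {..<dp u} \<inter> {i. fst (\<sigma> (u, i)) = v}"
      by auto
    then show ?thesis
      using dp_pos[OF that] unfolding kern_def srw_eq[OF that] pmf_map
      by (subst measure_pmf_of_set) (auto simp: of_bool_def sum.If_cases)
  qed
  \<comment> \<open>Split the geometric time at its first trial: with probability
    \<open>\<alpha>\<close> the time is 0 and the law is \<open>lam\<close>; otherwise one more step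
    follows a fresh copy of \<open>\<pi>\<close>. Taken pointwise, this is the stationarity
    equation.\<close>
  have "\<pi> = bind_pmf (bernoulli_pmf \<alpha>) (\<lambda>b. if b then lam else bind_pmf \<pi> kern)"
  proof -
    have "\<pi> = bind_pmf (bernoulli_pmf \<alpha>)
        (\<lambda>b. bind_pmf (if b then return_pmf 0 else map_pmf Suc (geometric_pmf \<alpha>)) law)"
      unfolding \<pi>_def using \<alpha> by (subst geometric_bind_pmf_unfold) (auto simp: bind_assoc_pmf)
    also have "\<dots> = bind_pmf (bernoulli_pmf \<alpha>) (\<lambda>b. if b then lam else bind_pmf \<pi> kern)"
      by (intro bind_pmf_cong)
        (auto simp: bind_return_pmf bind_map_pmf \<pi>_def bind_assoc_pmf law_def)
    finally show ?thesis .
  qed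
  then have "pmf \<pi> v = pmf (bind_pmf (bernoulli_pmf \<alpha>) (\<lambda>b. if b then lam else bind_pmf \<pi> kern)) v" for v
    by (rule arg_cong[where f = "\<lambda>p. pmf p v"])
  also have "\<dots> v = \<alpha> * pmf lam v + (1 - \<alpha>) * pmf (bind_pmf \<pi> kern) v" for v
    using \<alpha> by (subst pmf_bind_finite[of UNIV]) (auto simp: UNIV_bool)
  finally have rec: "pmf \<pi> v = \<alpha> * pmf lam v + (1 - \<alpha>) * pmf (bind_pmf \<pi> kern) v" for v .
  have one: "(\<Sum>u\<in>{1..n}. pmf \<pi> u) = 1"
    using \<pi>_set by (intro sum_pmf_eq_1) auto
  have "pmf \<pi> v = (\<Sum>u\<in>{1..n}. pmf \<pi> u * ((1 - \<alpha>) * srw \<sigma> u v + \<alpha> * pmf lam v))" for v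
  proof -
    have "pmf (bind_pmf \<pi> kern) v = (\<Sum>u\<in>{1..n}. pmf \<pi> u * srw \<sigma> u v)"
      using \<pi>_set by (simp add: pmf_bind_finite[of "{1..n}"] kern_pmf)
    moreover have "(\<Sum>u\<in>{1..n}. pmf \<pi> u * (\<alpha> * pmf lam v)) = \<alpha> * pmf lam v"
      by (simp only: sum_distrib_right[symmetric] one)
    ultimately show ?thesis
      by (subst rec) (simp add: distrib_left sum.distrib sum_distrib_left mult_ac)
  qed
  then have "stationary \<sigma> \<pi>"
    using \<pi>_set unfolding stationary_distribution_def pagerank_matrix_def by blast
  then show ?thesis ..
qed

lemma stationary_pagerank:
  assumes "\<sigma> \<in> matchings n dm dp"
  shows "stationary \<sigma> (pagerank n \<alpha> lam (srw \<sigma>))"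
  unfolding pagerank_def
proof -
  obtain \<pi> where \<pi>: "stationary \<sigma> \<pi>"
    using stationary_exists[OF assms] by blast
  show "stationary \<sigma> (THE \<pi>. stationary \<sigma> \<pi>)"
    using \<pi> stationary_unique[OF assms _ \<pi>] by (rule theI)
qed

lemmas rank_bounds = stationary_bounds[OF _ stationary_pagerank]

text \<open>Only paths of length one are kept. The vertex \<open>v\<close> has \<open>dm v\<close>
  incoming edges, each used with probability at least \<open>1 / K\<close> from a starting vertex of
  weight at least \<open>x\<close>. The bound holds for every matching.\<close>

lemma rank_ge:
  assumes \<sigma>: "\<sigma> \<in> matchings n dm dp" and v: "v \<in> {1..n}"
    and K: "\<And>u. u \<in> {1..n} \<Longrightarrow> real (dp u) \<le> K"
    and x: "\<And>u. u \<in> {1..n} \<Longrightarrow> x \<le> pmf lam u" "0 \<le> x"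
  shows "\<alpha> * (1 - \<alpha>) * x / K * real (dm v) \<le> rank \<sigma> v"
proof -
  have K0: "0 < K"
    using K[OF v] dp_pos[OF v] by linarith
  have bij: "bij_betw \<sigma> tails heads"
    using \<sigma> by (simp add: matchings_def)
  \<comment> \<open>Tails pointing to \<open>v\<close> correspond to heads at \<open>v\<close>, so
    multiple edges and loops are counted correctly.\<close>
  have "\<sigma> ` {t \<in> tails. fst (\<sigma> t) = v} = {h \<in> \<sigma> ` tails. fst h = v}"
    by blast
  then have "bij_betw \<sigma> {t \<in> tails. fst (\<sigma> t) = v} {h \<in> heads. fst h = v}"
    using bij unfolding bij_betw_def by (auto intro: inj_on_subset)
  then have "card {t \<in> tails. fst (\<sigma> t) = v} = card {h \<in> heads. fst h = v}"
    by (rule bij_betw_same_card)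
  also have "\<dots> = dm v"
    using card_half_edges_vertices[of "{v}" n dm] v by simp
  finally have "real (dm v) = (\<Sum>t\<in>tails. of_bool (fst (\<sigma> t) = v))"
    by (simp add: of_bool_def sum.If_cases Int_def)
  also have "\<dots> = (\<Sum>u\<in>{1..n}. \<Sum>i<dp u. of_bool (fst (\<sigma> (u, i)) = v))"
    by (subst sum.Sigma) (auto simp: half_edges_def split_beta simp del: sum_of_bool_eq)
  finally have dm: "real (dm v) = (\<Sum>u\<in>{1..n}. \<Sum>i<dp u. of_bool (fst (\<sigma> (u, i)) = v))" .
  have "x / K * real (dm v) = (\<Sum>u\<in>{1..n}. x * ((\<Sum>i<dp u. of_bool (fst (\<sigma> (u, i)) = v)) / K))"
    unfolding dm by (simp add: sum_distrib_left)
  also have "\<dots> \<le> (\<Sum>u\<in>{1..n}. pmf lam u * ((\<Sum>i<dp u. of_bool (fst (\<sigma> (u, i)) = v)) / real (dp u)))"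
    using K K0 x dp_pos
    by (intro sum_mono mult_mono divide_left_mono) (auto intro!: divide_nonneg_nonneg sum_nonneg)
  also have "\<dots> = (\<Sum>u\<in>{1..n}. pmf lam u * walk dp \<sigma> {} v 1 u)"
    by (simp add: step_def)
  finally have "\<alpha> * (1 - \<alpha>) * (x / K * real (dm v))
      \<le> \<alpha> * (1 - \<alpha>) * (\<Sum>u\<in>{1..n}. pmf lam u * walk dp \<sigma> {} v 1 u)"
    using \<alpha> by (intro mult_left_mono) auto
  also have "\<dots> \<le> partial_rank 2 {} v \<sigma>"
  proof -
    have "0 \<le> \<alpha> * (\<Sum>u\<in>{1..n}. pmf lam u * walk dp \<sigma> {} v 0 u)"
      using \<alpha> by (intro mult_nonneg_nonneg sum_nonneg walk_nonneg) auto
    then show ?thesis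
      by (simp add: truncated_rank_def numeral_2_eq_2)
  qed
  also have "\<dots> \<le> rank \<sigma> v"
    by (rule rank_bounds(1)[OF \<sigma> \<sigma> v])
  finally show ?thesis
    by simp
qed

end

section \<open>From moments to the number of large ranks\<close>

lemma card_markov:
  fixes f :: "'a \<Rightarrow> real"
  assumes "finite M" "\<And>x. x \<in> M \<Longrightarrow> 0 \<le> f x"
  shows "c * real (card {x \<in> M. c \<le> f x}) \<le> sum f M"
proof -
  have "c * real (card {x \<in> M. c \<le> f x}) = (\<Sum>x\<in>{x \<in> M. c \<le> f x}. c)"
    by simp
  also have "\<dots> \<le> sum f {x \<in> M. c \<le> f x}"
    by (intro sum_mono) auto
  also have "\<dots> \<le> sum f M"
    using assms by (intro sum_mono2) auto
  finally show ?thesis .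
qed

context pagerank_model
begin

text \<open>The threshold \<open>3 * \<tau>\<close> is split between the walks avoiding \<open>B\<close>, whose contribution is
  controlled by a high moment, the walks through \<open>B\<close>, controlled by Markov's inequality, and the
  walks of length at least \<open>L\<close>.\<close>

lemma card_many_large_ranks:
  fixes D \<Lambda> \<beta> \<gamma> \<tau> x :: real
  assumes B: "B \<subseteq> {1..n}" and D: "\<And>w. w \<in> {1..n} - B \<Longrightarrow> real (dm w) \<le> D" "0 \<le> D"
    and \<Lambda>: "\<And>u. u \<in> {1..n} \<Longrightarrow> pmf lam u \<le> \<Lambda>" "0 \<le> \<Lambda>"
    and p: "1 \<le> p" and L: "p * L < edges"
    and \<tau>: "0 < \<tau>" "(1 - \<alpha>) ^ L \<le> \<tau>" and x: "0 < x"
    and \<beta>: "(1 + 2 * real (p * L)) * (\<Lambda> + real L * (D / (real edges - real (p * L)))) \<le> \<beta> * \<tau>"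
    and \<gamma>: "real (card B) * \<Lambda> + real L * (real (\<Sum>w\<in>B. dm w) / (real edges - real L)) \<le> \<gamma> * \<tau>"
  shows "real (card {\<sigma> \<in> matchings n dm dp. x < real (card {v \<in> {1..n}. 3 * \<tau> < rank \<sigma> v})})
    \<le> (real n * \<beta> ^ p + \<gamma> / x) * real (card (matchings n dm dp))"
proof -
  let ?M = "matchings n dm dp"
  let ?f = "\<lambda>\<sigma>. \<Sum>v\<in>{1..n}. (partial_rank L B v \<sigma> / \<tau>) ^ p"
  let ?g = "\<lambda>\<sigma>. \<Sum>v\<in>{1..n}. partial_rank L {} v \<sigma> - partial_rank L B v \<sigma>"
  let ?a = "\<lambda>k. \<alpha> * (1 - \<alpha>) ^ k"
  have a_sum: "(\<Sum>k<L. ?a k) \<le> 1"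
  proof -
    have "(\<Sum>k<L. ?a k) = 1 - (1 - \<alpha>) ^ L"
      using one_diff_power_eq[of "1 - \<alpha>" L] by (simp add: sum_distrib_left)
    then show ?thesis
      using \<alpha> by simp
  qed
  have a0: "0 \<le> ?a k" for k
    using \<alpha> by simp
  have q0: "0 \<le> partial_rank L B' v \<sigma>" for B' v \<sigma>
    unfolding truncated_rank_def by (intro sum_nonneg mult_nonneg_nonneg a0 walk_nonneg pmf_nonneg)
  have diff0: "partial_rank L B v \<sigma> \<le> partial_rank L {} v \<sigma>" for v \<sigma>
    unfolding truncated_rank_def
    by (intro sum_mono mult_left_mono a0 walk_avoiding_le pmf_nonneg)
  have "L \<le> p * L"
    using p by simp
  then have L': "L < edges"
    using L by linarith
  have f: "sum ?f ?M \<le> real n * \<beta> ^ p * real (card ?M)"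
  proof -
    have "sum ?f ?M = (\<Sum>v\<in>{1..n}. (\<Sum>\<sigma>\<in>ext {}. partial_rank L B v \<sigma> ^ p) / \<tau> ^ p)"
      by (subst sum.swap) (simp add: power_divide sum_divide_distrib)
    also have "\<dots> \<le> (\<Sum>v\<in>{1..n}. (\<beta> * \<tau>) ^ p * card (ext {}) / \<tau> ^ p)"
    proof (intro sum_mono divide_right_mono)
      fix v assume v: "v \<in> {1..n}"
      show "(\<Sum>\<sigma>\<in>ext {}. partial_rank L B v \<sigma> ^ p) \<le> (\<beta> * \<tau>) ^ p * card (ext {})"
        by (rule truncated_rank_moment[where N = "p * L" and D = D and \<Lambda> = \<Lambda>];
            (fact a0 a_sum pmf_nonneg eq_refl[OF sum_lam] \<Lambda> L D v \<beta> | simp))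
    qed (use \<tau> in auto)
    also have "\<dots> = real n * \<beta> ^ p * real (card ?M)"
      using \<tau> by (simp add: power_mult_distrib)
    finally show ?thesis .
  qed
  have g: "sum ?g ?M \<le> \<gamma> * \<tau> * real (card ?M)"
    by (rule truncated_rank_through_mean[where \<Lambda> = \<Lambda>];
        fact a0 a_sum pmf_nonneg eq_refl[OF sum_lam] \<Lambda>(1) L' B \<gamma>)
  \<comment> \<open>Either some vertex receives mass \<open>\<tau>\<close> from walks avoiding
    \<open>B\<close>, which makes one summand of \<open>?f\<close> at least 1, or every vertex with
    rank above \<open>3 * \<tau>\<close> receives at least \<open>\<tau>\<close> through
    \<open>B\<close>, and more than \<open>x\<close> of them push \<open>?g\<close> to
    \<open>x * \<tau>\<close>.\<close>
  have sub: "{\<sigma> \<in> ?M. x < real (card {v \<in> {1..n}. 3 * \<tau> < rank \<sigma> v})}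
      \<subseteq> {\<sigma> \<in> ?M. 1 \<le> ?f \<sigma>} \<union> {\<sigma> \<in> ?M. x * \<tau> \<le> ?g \<sigma>}"
  proof (intro subsetI)
    fix \<sigma> assume "\<sigma> \<in> {\<sigma> \<in> ?M. x < real (card {v \<in> {1..n}. 3 * \<tau> < rank \<sigma> v})}"
    then have \<sigma>: "\<sigma> \<in> ?M" and many: "x < real (card {v \<in> {1..n}. 3 * \<tau> < rank \<sigma> v})"
      by auto
    show "\<sigma> \<in> {\<sigma> \<in> ?M. 1 \<le> ?f \<sigma>} \<union> {\<sigma> \<in> ?M. x * \<tau> \<le> ?g \<sigma>}"
    proof (cases "\<exists>v\<in>{1..n}. \<tau> \<le> partial_rank L B v \<sigma>")
      case True
      then obtain v where v: "v \<in> {1..n}" "\<tau> \<le> partial_rank L B v \<sigma>"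
        by blast
      have "1 \<le> (partial_rank L B v \<sigma> / \<tau>) ^ p"
        using v \<tau> by (intro one_le_power) simp
      also have "\<dots> \<le> ?f \<sigma>"
        using v q0 \<tau> by (intro member_le_sum) auto
      finally show ?thesis
        using \<sigma> by simp
    next
      case False
      have "{v \<in> {1..n}. 3 * \<tau> < rank \<sigma> v}
          \<subseteq> {v \<in> {1..n}. \<tau> \<le> partial_rank L {} v \<sigma> - partial_rank L B v \<sigma>}"
      proof safe
        fix v assume v: "v \<in> {1..n}" "3 * \<tau> < rank \<sigma> v"
        have "rank \<sigma> v \<le> partial_rank L {} v \<sigma> + (1 - \<alpha>) ^ L"
          by (rule rank_bounds(2)[OF \<sigma> \<sigma> v(1)])
        then show "\<tau> \<le> partial_rank L {} v \<sigma> - partial_rank L B v \<sigma>"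
          using v False \<tau> by force
      qed
      then have "real (card {v \<in> {1..n}. 3 * \<tau> < rank \<sigma> v})
          \<le> real (card {v \<in> {1..n}. \<tau> \<le> partial_rank L {} v \<sigma> - partial_rank L B v \<sigma>})"
        by (intro of_nat_mono card_mono) auto
      then have "x * \<tau> \<le> \<tau> * real (card {v \<in> {1..n}. \<tau> \<le> partial_rank L {} v \<sigma> - partial_rank L B v \<sigma>})"
        using many \<tau> by (simp add: mult.commute)
      also have "\<dots> \<le> ?g \<sigma>"
        using diff0 by (intro card_markov) auto
      finally show ?thesis
        using \<sigma> by simp
    qed
  qed
  have "real (card {\<sigma> \<in> ?M. x < real (card {v \<in> {1..n}. 3 * \<tau> < rank \<sigma> v})})
      \<le> real (card ({\<sigma> \<in> ?M. 1 \<le> ?f \<sigma>} \<union> {\<sigma> \<in> ?M. x * \<tau> \<le> ?g \<sigma>}))"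
    by (intro of_nat_mono card_mono[OF _ sub]) simp
  also have "\<dots> \<le> real (card {\<sigma> \<in> ?M. 1 \<le> ?f \<sigma>}) + real (card {\<sigma> \<in> ?M. x * \<tau> \<le> ?g \<sigma>})"
    by (simp only: of_nat_add[symmetric] of_nat_le_iff card_Un_le)
  also have "real (card {\<sigma> \<in> ?M. 1 \<le> ?f \<sigma>}) \<le> real n * \<beta> ^ p * real (card ?M)"
    using card_markov[of ?M ?f 1] f q0 \<tau> by (simp add: sum_nonneg)
  also have "real (card {\<sigma> \<in> ?M. x * \<tau> \<le> ?g \<sigma>}) \<le> \<gamma> / x * real (card ?M)"
  proof -
    have "x * \<tau> * real (card {\<sigma> \<in> ?M. x * \<tau> \<le> ?g \<sigma>}) \<le> \<gamma> * \<tau> * real (card ?M)"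
      using diff0 g by (intro order_trans[OF card_markov]) (auto intro: sum_nonneg)
    then have "\<tau> * (x * real (card {\<sigma> \<in> ?M. x * \<tau> \<le> ?g \<sigma>})) \<le> \<tau> * (\<gamma> * real (card ?M))"
      by (simp only: mult_ac)
    then have "x * real (card {\<sigma> \<in> ?M. x * \<tau> \<le> ?g \<sigma>}) \<le> \<gamma> * real (card ?M)"
      using \<tau>(1) mult_le_cancel_left_pos by blast
    then show ?thesis
      using x by (simp add: field_simps)
  qed
  finally show ?thesis
    by (simp add: distrib_right)
qed

end

section \<open>Events of high probability and power laws\<close>

lemma whp_iff: "whp M E \<longleftrightarrow> (\<lambda>n. measure_pmf.prob (M n) {\<omega>. \<not> E n \<omega>}) \<longlonglongrightarrow> 0"
proof -
  have eq: "measure_pmf.prob (M n) {\<omega>. E n \<omega>} = 1 - measure_pmf.prob (M n) {\<omega>. \<not> E n \<omega>}" for n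
    using measure_pmf.prob_compl[of "{\<omega>. \<not> E n \<omega>}" "M n"] by (simp add: Compl_eq_Diff_UNIV[symmetric] Collect_neg_eq)
  show ?thesis
  proof
    assume "whp M E"
    then have "(\<lambda>n. 1 - measure_pmf.prob (M n) {\<omega>. E n \<omega>}) \<longlonglongrightarrow> 1 - 1"
      unfolding whp_def by (intro tendsto_intros)
    then show "(\<lambda>n. measure_pmf.prob (M n) {\<omega>. \<not> E n \<omega>}) \<longlonglongrightarrow> 0"
      by (simp add: eq)
  next
    assume "(\<lambda>n. measure_pmf.prob (M n) {\<omega>. \<not> E n \<omega>}) \<longlonglongrightarrow> 0"
    then have "(\<lambda>n. 1 - measure_pmf.prob (M n) {\<omega>. \<not> E n \<omega>}) \<longlonglongrightarrow> 1 - 0"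
      by (intro tendsto_intros)
    then show "whp M E"
      by (simp add: whp_def eq)
  qed
qed

lemma whpI:
  assumes "\<forall>\<^sub>F n in sequentially. measure_pmf.prob (M n) {\<omega>. \<not> E n \<omega>} \<le> \<delta> n" "\<delta> \<longlonglongrightarrow> 0"
  shows "whp M E"
  unfolding whp_iff
  by (rule tendsto_sandwich[OF _ assms(1) tendsto_const assms(2)]) simp

text \<open>The implication is asked for only on the support, since the bounds on PageRank hold only
  for multigraphs that come from a matching.\<close>

lemma whp_mono:
  assumes E: "whp M E"
    and sub: "\<forall>\<^sub>F n in sequentially. \<forall>\<omega>\<in>set_pmf (M n). E n \<omega> \<longrightarrow> F n \<omega>"
  shows "whp M F"
proof (rule whpI)
  show "\<forall>\<^sub>F n in sequentially.
      measure_pmf.prob (M n) {\<omega>. \<not> F n \<omega>} \<le> measure_pmf.prob (M n) {\<omega>. \<not> E n \<omega>}"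
    using sub
  proof eventually_elim
    case (elim n)
    have "measure_pmf.prob (M n) {\<omega>. \<not> F n \<omega>} = measure_pmf.prob (M n) ({\<omega>. \<not> F n \<omega>} \<inter> set_pmf (M n))"
      by (simp add: measure_Int_set_pmf)
    also have "\<dots> \<le> measure_pmf.prob (M n) {\<omega>. \<not> E n \<omega>}"
      using elim by (intro measure_pmf.finite_measure_mono) auto
    finally show ?case .
  qed
  show "(\<lambda>n. measure_pmf.prob (M n) {\<omega>. \<not> E n \<omega>}) \<longlonglongrightarrow> 0"
    using E by (simp add: whp_iff)
qed

lemma whp_conj:
  assumes "whp M E" "whp M F"
  shows "whp M (\<lambda>n \<omega>. E n \<omega> \<and> F n \<omega>)"
proof (rule whpI)
  show "\<forall>\<^sub>F n in sequentially. measure_pmf.prob (M n) {\<omega>. \<not> (E n \<omega> \<and> F n \<omega>)}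
      \<le> measure_pmf.prob (M n) {\<omega>. \<not> E n \<omega>} + measure_pmf.prob (M n) {\<omega>. \<not> F n \<omega>}"
  proof (intro always_eventually allI)
    fix n
    have "{\<omega>. \<not> (E n \<omega> \<and> F n \<omega>)} = {\<omega>. \<not> E n \<omega>} \<union> {\<omega>. \<not> F n \<omega>}"
      by blast
    then show "measure_pmf.prob (M n) {\<omega>. \<not> (E n \<omega> \<and> F n \<omega>)}
        \<le> measure_pmf.prob (M n) {\<omega>. \<not> E n \<omega>} + measure_pmf.prob (M n) {\<omega>. \<not> F n \<omega>}"
      using measure_Un_le[of "{\<omega>. \<not> E n \<omega>}" "measure_pmf (M n)" "{\<omega>. \<not> F n \<omega>}"] by simp
  qed
  show "(\<lambda>n. measure_pmf.prob (M n) {\<omega>. \<not> E n \<omega>} + measure_pmf.prob (M n) {\<omega>. \<not> F n \<omega>})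
      \<longlonglongrightarrow> 0"
    using assms tendsto_add[of _ 0 _ _ 0] by (force simp: whp_iff)
qed

lemma whp_True: "whp M (\<lambda>n \<omega>. True)"
  by (simp add: whp_def)

lemma whp_ball_finite:
  assumes "finite J" "\<And>j. j \<in> J \<Longrightarrow> whp M (\<lambda>n \<omega>. E j n \<omega>)"
  shows "whp M (\<lambda>n \<omega>. \<forall>j\<in>J. E j n \<omega>)"
  using assms by (induction J) (auto intro: whp_conj whp_True)

section \<open>Monotonicity of tails and degree sums above a threshold\<close>

lemma tail_antimono: "s \<le> t \<Longrightarrow> tail \<mu> t \<le> tail \<mu> s"
  by (intro measure_pmf.finite_measure_mono) auto

text \<open>Cut the degrees into levels on a logarithmic scale. A level starting at
  \<open>n powr b\<close> has about \<open>n powr (1 - b * \<kappa>)\<close> vertices of degree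
  about \<open>n powr b\<close>; since \<open>\<kappa> > 1\<close>, the lowest level
  \<open>b = a\<close> dominates.\<close>

lemma power_law_sum_above:
  fixes d :: "nat \<Rightarrow> nat \<Rightarrow> nat"
  assumes pl: "power_law \<kappa> (\<lambda>n. empirical_measure n (\<lambda>v. real (d n v)))"
    and \<kappa>: "1 < \<kappa>" and a: "0 < a" "a < 1 / \<kappa>" and s: "0 < s"
  shows "\<forall>\<^sub>F n in sequentially.
    (\<Sum>v\<in>{v \<in> {1..n}. real n powr a < real (d n v)}. real (d n v))
      \<le> real n powr (1 + a * (1 - \<kappa>) + s)"
proof -
  \<comment> \<open>Three parts are lost within a level, the fourth absorbs the number of
    levels.\<close>
  define \<delta> where "\<delta> = s / 4"
  have \<delta>: "0 < \<delta>"
    using s by (simp add: \<delta>_def)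
  define g where "g = 1 / \<kappa> - a"
  have g: "0 < g"
    using a by (simp add: g_def)
  \<comment> \<open>The number of levels is independent of \<open>n\<close>, so the power law is
    used at finitely many exponents; their mesh \<open>h\<close> is at most
    \<open>\<delta>\<close>.\<close>
  obtain J :: nat where J: "g / \<delta> < real J"
    using reals_Archimedean2 by blast
  then have "0 < real J"
    using g \<delta> by (smt (verit) divide_pos_pos)
  then have J0: "0 < J"
    by simp
  define h where "h = g / real J"
  have h: "0 < h" "h \<le> \<delta>"
    using J J0 g \<delta> by (auto simp: h_def field_simps)
  define b where "b = (\<lambda>j::nat. a + real j * h)"
  have b: "0 < b j" "b j < 1 / \<kappa>" "a \<le> b j" if "j < J" for j
  proof -
    have "real j * h < real J * h"
      using that h by simp
    also have "\<dots> = g"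
      using J0 by (simp add: h_def)
    finally show "b j < 1 / \<kappa>"
      by (simp add: b_def g_def)
    show "0 < b j" "a \<le> b j"
      using a h by (auto simp: b_def add_pos_nonneg)
  qed
  have ev: "\<forall>\<^sub>F n in sequentially. \<forall>j\<in>{..<J}.
      pl_upper \<kappa> \<delta> (b j) n (empirical_measure n (\<lambda>v. real (d n v))) \<and>
      pl_cutoff \<kappa> \<delta> n (empirical_measure n (\<lambda>v. real (d n v)))"
  proof (intro eventually_ball_finite ballI)
    fix j assume "j \<in> {..<J}"
    then have "b j \<in> {0<..<1 / \<kappa>}"
      using b by simp
    then have "\<forall>\<^sub>F n in sequentially. pl_lower \<kappa> \<delta> (b j) n (empirical_measure n (\<lambda>v. real (d n v))) \<and>
        pl_upper \<kappa> \<delta> (b j) n (empirical_measure n (\<lambda>v. real (d n v))) \<and>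
        pl_cutoff \<kappa> \<delta> n (empirical_measure n (\<lambda>v. real (d n v)))"
      using pl \<delta> unfolding power_law_def by blast
    then show "\<forall>\<^sub>F n in sequentially. pl_upper \<kappa> \<delta> (b j) n (empirical_measure n (\<lambda>v. real (d n v))) \<and>
        pl_cutoff \<kappa> \<delta> n (empirical_measure n (\<lambda>v. real (d n v)))"
      by (rule eventually_mono) blast
  qed simp
  have J_le: "\<forall>\<^sub>F n in sequentially. real J \<le> real n powr \<delta>"
    using \<delta> by real_asymp
  show ?thesis
    using ev J_le eventually_ge_at_top[of 1]
  proof eventually_elim
    case (elim n)
    let ?S = "\<lambda>t. {v \<in> {1..n}. t < real (d n v)}"
    have n: "1 \<le> n" "1 \<le> real n"
      using elim by auto
    have card_le: "real (card (?S (real n powr b j))) \<le> real n * real n powr (- b j * \<kappa> + \<delta>)"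
      if "j < J" for j
    proof -
      have "real (card (?S (real n powr b j))) / real n \<le> real n powr (- b j * \<kappa> + \<delta>)"
        using elim(1) that tail_empirical_measure[OF n(1), of "\<lambda>v. real (d n v)"]
        by (simp add: pl_upper_def)
      then show ?thesis
        using n by (simp add: field_simps)
    qed
    have max_d: "real (d n v) \<le> real n powr (1 / \<kappa> + \<delta>)" if "v \<in> {1..n}" for v
    proof -
      have "real (card (?S (real n powr (1 / \<kappa> + \<delta>)))) / real n = 0"
        using elim(1) J0 tail_empirical_measure[OF n(1), of "\<lambda>v. real (d n v)"]
        by (auto simp: pl_cutoff_def)
      then have "?S (real n powr (1 / \<kappa> + \<delta>)) = {}"
        using n by simp
      then show ?thesis
        using that by force
    qed
    have pointwise: "real (d n v) \<le>
        (\<Sum>j<J. if real n powr b j < real (d n v) then real n powr (b j + 2 * \<delta>) else 0)"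
      if v: "v \<in> ?S (real n powr a)" for v
    proof -
      \<comment> \<open>The highest level below the degree of \<open>v\<close>. The degree is then
        bounded by the next grid point or, at the last level, by the cutoff
        \<open>1 / \<kappa> + \<delta>\<close>; \<open>2 * \<delta>\<close> covers both
        cases.\<close>
      define j where "j = Max {j. j < J \<and> real n powr b j < real (d n v)}"
      have fin: "finite {j. j < J \<and> real n powr b j < real (d n v)}"
        by simp
      have "0 \<in> {j. j < J \<and> real n powr b j < real (d n v)}"
        using v J0 by (simp add: b_def)
      then have "j \<in> {j. j < J \<and> real n powr b j < real (d n v)}"
        unfolding j_def by (intro Max_in fin) blast
      then have j: "j < J" "real n powr b j < real (d n v)"
        by simp_all
      have "real (d n v) \<le> real n powr (b j + 2 * \<delta>)"
      proof (cases "Suc j < J")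
        case True
        have "\<not> real n powr b (Suc j) < real (d n v)"
        proof
          assume "real n powr b (Suc j) < real (d n v)"
          then have "Suc j \<le> j"
            unfolding j_def using True by (intro Max_ge fin) (simp add: j_def)
          then show False
            by simp
        qed
        then have "real (d n v) \<le> real n powr b (Suc j)"
          by simp
        also have "\<dots> \<le> real n powr (b j + 2 * \<delta>)"
          using n h \<delta> by (intro powr_mono) (auto simp: b_def algebra_simps)
        finally show ?thesis .
      next
        case False
        then have "J = Suc j"
          using j by simp
        then have "real (Suc j) * h = g"
          by (simp add: h_def)
        then have "b j + h = 1 / \<kappa>"
          by (simp add: b_def g_def algebra_simps)
        then have "real n powr (1 / \<kappa> + \<delta>) \<le> real n powr (b j + 2 * \<delta>)"
          using n h by (intro powr_mono) auto
        then show ?thesis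
          using max_d[of v] v by auto
      qed
      also have "\<dots> = (if real n powr b j < real (d n v) then real n powr (b j + 2 * \<delta>) else 0)"
        using j by simp
      also have "\<dots> \<le> (\<Sum>j<J. if real n powr b j < real (d n v) then real n powr (b j + 2 * \<delta>) else 0)"
        using j by (intro member_le_sum) auto
      finally show ?thesis .
    qed
    have "(\<Sum>v\<in>?S (real n powr a). real (d n v)) \<le>
        (\<Sum>v\<in>?S (real n powr a). \<Sum>j<J. if real n powr b j < real (d n v) then real n powr (b j + 2 * \<delta>) else 0)"
      by (intro sum_mono pointwise)
    also have "\<dots> \<le>
        (\<Sum>v\<in>{1..n}. \<Sum>j<J. if real n powr b j < real (d n v) then real n powr (b j + 2 * \<delta>) else 0)"
      by (intro sum_mono2) (auto intro: sum_nonneg)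
    also have "\<dots> = (\<Sum>j<J. real n powr (b j + 2 * \<delta>) * real (card (?S (real n powr b j))))"
      by (subst sum.swap) (simp add: sum.If_cases Int_def mult.commute)
    also have "\<dots> \<le> (\<Sum>j<J. real n powr (1 + a * (1 - \<kappa>) + 3 * \<delta>))"
    proof (intro sum_mono)
      fix j assume "j \<in> {..<J}"
      then have j: "j < J"
        by simp
      have "real n powr (b j + 2 * \<delta>) * real (card (?S (real n powr b j)))
          \<le> real n powr (b j + 2 * \<delta>) * (real n powr 1 * real n powr (- b j * \<kappa> + \<delta>))"
        using card_le[OF j] n by (intro mult_left_mono) auto
      also have "\<dots> = real n powr (1 + b j * (1 - \<kappa>) + 3 * \<delta>)"
        by (simp only: powr_add[symmetric]) (simp add: algebra_simps)
      also have "\<dots> \<le> real n powr (1 + a * (1 - \<kappa>) + 3 * \<delta>)"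
        using n b(3)[OF j] \<kappa> by (intro powr_mono) (auto intro: mult_right_mono_neg)
      finally show "real n powr (b j + 2 * \<delta>) * real (card (?S (real n powr b j)))
          \<le> real n powr (1 + a * (1 - \<kappa>) + 3 * \<delta>)" .
    qed
    also have "\<dots> = real J * real n powr (1 + a * (1 - \<kappa>) + 3 * \<delta>)"
      by simp
    also have "\<dots> \<le> real n powr \<delta> * real n powr (1 + a * (1 - \<kappa>) + 3 * \<delta>)"
      using elim by (intro mult_right_mono) auto
    also have "\<dots> = real n powr (1 + a * (1 - \<kappa>) + s)"
      by (simp only: powr_add[symmetric]) (simp add: \<delta>_def algebra_simps)
    finally show ?case .
  qed
qed

section \<open>Tails of the PageRank distribution\<close>

locale pagerank_sequence =
  fixes dm dp :: "nat \<Rightarrow> nat \<Rightarrow> nat" and lam :: "nat \<Rightarrow> nat pmf" and K \<kappa> \<alpha> :: real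
  assumes bidegree: "\<And>n. n \<ge> 1 \<Longrightarrow> (\<Sum>v\<in>{1..n}. dp n v) = (\<Sum>v\<in>{1..n}. dm n v)"
    and min_out: "\<And>n v. v \<in> {1..n} \<Longrightarrow> dp n v \<ge> 2"
    and max_out: "\<And>n v. v \<in> {1..n} \<Longrightarrow> real (dp n v) \<le> K"
    and kappa: "\<kappa> > 1"
    and in_degrees: "power_law \<kappa> (\<lambda>n. empirical_measure n (\<lambda>v. real (dm n v)))"
    and alpha: "\<alpha> \<in> {0<..<1}"
    and lam_on: "\<And>n. n \<ge> 1 \<Longrightarrow> set_pmf (lam n) \<subseteq> {1..n}"
    and lam_bounds: "\<And>\<epsilon>::real. \<epsilon> > 0 \<Longrightarrow> \<forall>\<^sub>F n in sequentially. \<forall>x\<in>{1..n}.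
          real n powr (- 1 - \<epsilon>) \<le> pmf (lam n) x \<and> pmf (lam n) x \<le> real n powr (- 1 + \<epsilon>)"
begin

abbreviation score :: "nat \<Rightarrow> (nat \<times> nat) multiset \<Rightarrow> nat \<Rightarrow> real" where
  "score n G v \<equiv> real n * pmf (pagerank n \<alpha> (lam n) (srw_matrix (dp n) G)) v"

abbreviation graph :: "nat \<Rightarrow> (nat \<times> nat) multiset pmf" where
  "graph n \<equiv> dcm n (dm n) (dp n)"

lemma model: "n \<ge> 1 \<Longrightarrow> pagerank_model n (dm n) (dp n) \<alpha> (lam n)"
  using bidegree min_out alpha lam_on by unfold_locales (auto intro: less_le_trans[of 0 2])

lemma prob_graph:
  assumes "n \<ge> 1"
  shows "measure_pmf.prob (graph n) {G. P G} =
    real (card {\<sigma> \<in> matchings n (dm n) (dp n). P (graph_of_matching n (dp n) \<sigma>)})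
      / real (card (matchings n (dm n) (dp n)))"
proof -
  interpret pagerank_model n "dm n" "dp n" \<alpha> "lam n"
    by (rule model[OF assms])
  show ?thesis
    unfolding dcm_def using matchings_nonempty
    by (simp add: measure_pmf_of_set vimage_def Int_def)
qed

lemma set_pmf_graph:
  assumes "n \<ge> 1"
  shows "set_pmf (graph n) = graph_of_matching n (dp n) ` matchings n (dm n) (dp n)"
proof -
  interpret pagerank_model n "dm n" "dp n" \<alpha> "lam n"
    by (rule model[OF assms])
  show ?thesis
    unfolding dcm_def using matchings_nonempty by simp
qed

text \<open>The vertices of in-degree above \<open>n powr (a - 2 * s)\<close> play the role of \<open>B\<close> in
  \<open>card_many_large_ranks\<close>, and the moment has order about \<open>2 / s\<close>.\<close>

lemma whp_few_large_scores:
  fixes S x :: "nat \<Rightarrow> real"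
  assumes s: "0 < s" "3 * s \<le> a"
    and S: "\<forall>\<^sub>F n in sequentially.
      (\<Sum>v\<in>{v \<in> {1..n}. real n powr (a - 2 * s) < real (dm n v)}. real (dm n v)) \<le> S n"
    and x: "\<forall>\<^sub>F n in sequentially. 0 < x n"
    and lim: "(\<lambda>n. real n powr (2 * s - a) * S n / x n) \<longlonglongrightarrow> 0"
  shows "whp graph (\<lambda>n G. real (card {v \<in> {1..n}. real n powr a < score n G v}) \<le> x n)"
proof -
  \<comment> \<open>With \<open>s * p\<close> at least 2, the union bound over \<open>n\<close>
    vertices gives \<open>n * n powr (- s * p)\<close>, at most \<open>1 / n\<close>.\<close>
  define p where "p = nat \<lceil>2 / s\<rceil>"
  \<comment> \<open>Chosen so that \<open>(1 - \<alpha>) powr (c * ln n) = 1 / n\<close>.\<close>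
  define c where "c = - 1 / ln (1 - \<alpha>)"
  have ps: "2 \<le> s * real p" "1 \<le> p"
  proof -
    have "2 / s \<le> real p"
      unfolding p_def by linarith
    then show "2 \<le> s * real p"
      using s by (simp add: field_simps)
    then show "1 \<le> p"
      by (cases p) auto
  qed
  have ln_neg: "ln (1 - \<alpha>) < 0"
    using alpha by simp
  then have c: "0 < c"
    by (simp add: c_def divide_neg_neg)
  have a: "0 < a"
    using s by linarith
  have p0: "0 < real p"
    using ps by simp
  \<comment> \<open>Powers of \<open>n\<close> beat the logarithmic walk length; the factors 3
    compensate for the 3 in \<open>\<tau>\<close>.\<close>
  have asymp:
    "\<forall>\<^sub>F n in sequentially.
      3 * (1 + 2 * real p * (c * ln (real n) + 1)) * (2 + c * ln (real n)) \<le> real n powr s"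
    "\<forall>\<^sub>F n in sequentially. 3 * (real n powr s + (c * ln (real n) + 1)) \<le> real n powr (2 * s)"
    "\<forall>\<^sub>F n in sequentially. real p * (c * ln (real n) + 1) \<le> real n"
    "\<forall>\<^sub>F n in sequentially. 3 \<le> real n powr a"
    using s(1) c a p0 by real_asymp+
  have "\<forall>\<^sub>F n in sequentially. measure_pmf.prob (graph n)
      {G. \<not> real (card {v \<in> {1..n}. real n powr a < score n G v}) \<le> x n}
    \<le> 1 / real n + real n powr (2 * s - a) * S n / x n"
    using asymp S x lam_bounds[OF s(1)] eventually_ge_at_top[of 1]
  proof eventually_elim
    case (elim n)
    then have n: "1 \<le> n" "0 < real n" "1 \<le> real n"
      by auto
    interpret pagerank_model n "dm n" "dp n" \<alpha> "lam n"
      by (rule model[OF n(1)])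
    define L where "L = nat \<lceil>c * ln (real n)\<rceil>"
    define \<tau> where "\<tau> = real n powr (a - 1) / 3"
    define B where "B = {v \<in> {1..n}. real n powr (a - 2 * s) < real (dm n v)}"
    define D where "D = real n powr (a - 2 * s)"
    define len where "len = c * ln (real n) + 1"
    have cln: "0 \<le> c * ln (real n)"
      using c n by simp
    then have L: "c * ln (real n) \<le> real L" "real L \<le> len" "1 \<le> len"
      unfolding L_def len_def by linarith+
    have pL: "real (p * L) \<le> real p * len"
      using L p0 by simp
    also have "\<dots> \<le> real n"
      using elim(3) by (simp add: len_def)
    finally have pLn: "real (p * L) \<le> real n" .
    \<comment> \<open>Out-degrees at least 2 give at least \<open>2 * n\<close> edges, while at most
      \<open>n\<close> are revealed, so at least \<open>n\<close> heads always remain free.\<close>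
    have "(\<Sum>v\<in>{1..n}. 2) \<le> (\<Sum>v\<in>{1..n}. dp n v)"
      by (intro sum_mono min_out)
    then have "2 * n \<le> edges"
      using bidegree[OF n(1)] by (simp add: card_half_edges)
    then have edges: "2 * real n \<le> real edges"
      by linarith
    have "L \<le> p * L"
      using ps by simp
    then have "real L \<le> real (p * L)"
      by (simp only: of_nat_le_iff)
    then have Ln: "real L \<le> real n"
      using pLn by linarith
    have gap: "real n \<le> real edges - real (p * L)" "real n \<le> real edges - real L"
      using edges pLn Ln by linarith+
    have \<tau>0: "0 < \<tau>"
      using n by (simp add: \<tau>_def)
    have tail_le: "(1 - \<alpha>) ^ L \<le> \<tau>"
    proof -
      have "real L * ln (1 - \<alpha>) \<le> c * ln (real n) * ln (1 - \<alpha>)"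
        using L ln_neg by (intro mult_right_mono_neg) auto
      also have "\<dots> = - ln (real n)"
        using ln_neg by (simp add: c_def)
      finally have "exp (real L * ln (1 - \<alpha>)) \<le> exp (- ln (real n))"
        by simp
      then have "(1 - \<alpha>) ^ L \<le> 1 / real n"
        using n alpha by (simp add: exp_of_nat_mult exp_minus inverse_eq_divide)
      also have "\<dots> \<le> (real n powr a / 3) / real n"
        using n elim(4) by (intro divide_right_mono) auto
      also have "\<dots> = \<tau>"
        using n by (simp add: \<tau>_def powr_diff)
      finally show ?thesis .
    qed
    have D: "real (dm n w) \<le> D" if "w \<in> {1..n} - B" for w
      using that by (auto simp: B_def D_def)
    have D0: "0 \<le> D"
      by (simp add: D_def)
    define \<Lambda> where "\<Lambda> = real n powr (- 1 + s)"
    have \<Lambda>: "pmf (lam n) u \<le> \<Lambda>" if "u \<in> {1..n}" for u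
      using elim that by (auto simp: \<Lambda>_def)
    have \<Lambda>0: "0 \<le> \<Lambda>"
      by (simp add: \<Lambda>_def)
    \<comment> \<open>Entering costs \<open>n powr (a - 2 * s - 1)\<close> up to logarithms, against
      \<open>\<tau>\<close> of order \<open>n powr (a - 1)\<close>. One factor
      \<open>n powr s\<close> pays for the logarithms, the other is the gain per moment. The
      condition \<open>3 * s \<le> a\<close> makes \<open>\<Lambda>\<close> fit under the same
      bound.\<close>
    have \<beta>: "(1 + 2 * real (p * L)) * (\<Lambda> + real L * (D / (real edges - real (p * L))))
        \<le> real n powr (- s) * \<tau>"
    proof -
      have "\<Lambda> \<le> real n powr (a - 2 * s - 1)"
        unfolding \<Lambda>_def using n s by (intro powr_mono) auto
      moreover have "real L * (D / (real edges - real (p * L))) \<le> len * (D / real n)"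
        using L D0 gap n by (intro mult_mono divide_left_mono) auto
      moreover have "D / real n = real n powr (a - 2 * s - 1)"
        using n by (simp add: D_def powr_diff)
      ultimately have "\<Lambda> + real L * (D / (real edges - real (p * L))) \<le> (1 + len) * real n powr (a - 2 * s - 1)"
        by (simp add: algebra_simps)
      moreover have "1 + 2 * real (p * L) \<le> 1 + 2 * (real p * len)"
        using pL by simp
      moreover have "0 \<le> \<Lambda> + real L * (D / (real edges - real (p * L)))"
        using \<Lambda>0 D0 gap n by (intro add_nonneg_nonneg mult_nonneg_nonneg divide_nonneg_nonneg) auto
      ultimately have "(1 + 2 * real (p * L)) * (\<Lambda> + real L * (D / (real edges - real (p * L))))
          \<le> (1 + 2 * (real p * len)) * ((1 + len) * real n powr (a - 2 * s - 1))"
        using L by (intro mult_mono) auto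
      also have "\<dots> = 3 * (1 + 2 * real p * len) * (1 + len) * (real n powr (a - 2 * s - 1) / 3)"
        by simp
      also have "\<dots> \<le> real n powr s * (real n powr (a - 2 * s - 1) / 3)"
        using elim(1) by (intro mult_right_mono) (auto simp: len_def add_ac)
      also have "\<dots> = real n powr (s + (a - 2 * s - 1)) / 3"
        by (simp only: powr_add times_divide_eq_right)
      also have "s + (a - 2 * s - 1) = - s + (a - 1)"
        by simp
      also have "real n powr (- s + (a - 1)) / 3 = real n powr (- s) * \<tau>"
        by (simp only: \<tau>_def powr_add times_divide_eq_right)
      finally show ?thesis .
    qed
    have sumB: "real (\<Sum>w\<in>B. dm n w) \<le> S n"
      using elim(5) by (simp add: B_def)
    \<comment> \<open>Vertices of \<open>B\<close> have positive in-degree, so their number is at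
      most their total in-degree.\<close>
    have cardB: "real (card B) \<le> S n"
    proof -
      have "1 \<le> dm n w" if "w \<in> B" for w
      proof -
        have "0 \<le> real n powr (a - 2 * s)"
          by simp
        also have "\<dots> < real (dm n w)"
          using that by (simp add: B_def)
        finally show ?thesis
          by simp
      qed
      then have "(\<Sum>w\<in>B. 1) \<le> (\<Sum>w\<in>B. dm n w)"
        by (intro sum_mono)
      then have "card B \<le> (\<Sum>w\<in>B. dm n w)"
        by (simp only: card_eq_sum)
      then have "real (card B) \<le> real (\<Sum>w\<in>B. dm n w)"
        by (simp only: of_nat_le_iff)
      then show ?thesis
        using sumB by (rule order_trans)
    qed
    have S0: "0 \<le> S n"
      using cardB by linarith
    have \<gamma>: "real (card B) * \<Lambda> + real L * (real (\<Sum>w\<in>B. dm n w) / (real edges - real L))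
        \<le> real n powr (2 * s - a) * S n * \<tau>"
    proof -
      have "real (card B) * \<Lambda> \<le> S n * (real n powr s / real n)"
      proof -
        have "\<Lambda> = real n powr s / real n"
          using n by (simp add: \<Lambda>_def powr_diff)
        moreover have "real (card B) * \<Lambda> \<le> S n * \<Lambda>"
          by (rule mult_right_mono[OF cardB \<Lambda>0])
        ultimately show ?thesis
          by simp
      qed
      moreover have "real L * (real (\<Sum>w\<in>B. dm n w) / (real edges - real L)) \<le> len * (S n / real n)"
        using L sumB S0 gap n by (intro mult_mono frac_le) (auto intro!: divide_nonneg_nonneg sum_nonneg)
      ultimately have "real (card B) * \<Lambda> + real L * (real (\<Sum>w\<in>B. dm n w) / (real edges - real L))
          \<le> S n * (real n powr s / real n) + len * (S n / real n)"
        by (rule add_mono)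
      also have "\<dots> = S n / real n * (real n powr s + len)"
        by (simp add: algebra_simps)
      also have "\<dots> \<le> S n / real n * (real n powr (2 * s) / 3)"
        using elim(2) S0 n by (intro mult_left_mono) (auto simp: len_def)
      also have "\<dots> = S n * (real n powr (2 * s) * real n powr - 1) / 3"
        using n by (simp add: powr_minus_divide)
      also have "real n powr (2 * s) * real n powr - 1 = real n powr (2 * s - a) * real n powr (a - 1)"
        by (simp only: powr_add[symmetric]) simp
      finally show ?thesis
        by (simp add: \<tau>_def mult_ac)
    qed
    have "real (p * L) < real edges"
      using gap n by linarith
    then have pLe: "p * L < edges"
      by (simp only: of_nat_less_iff)
    have BV: "B \<subseteq> {1..n}"
      by (auto simp: B_def)
    let ?M = "matchings n (dm n) (dp n)"
    let ?G = "graph_of_matching n (dp n)"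
    have main: "real (card {\<sigma> \<in> ?M. x n < real (card {v \<in> {1..n}. 3 * \<tau> < rank \<sigma> v})})
        \<le> (real n * (real n powr (- s)) ^ p + real n powr (2 * s - a) * S n / x n) * real (card ?M)"
      by (rule card_many_large_ranks[OF BV D D0 \<Lambda> \<Lambda>0 ps(2) pLe \<tau>0 tail_le elim(6) \<beta> \<gamma>])
    have threshold: "3 * \<tau> < y \<longleftrightarrow> real n powr a < real n * y" for y
      using n by (simp add: \<tau>_def powr_diff field_simps)
    have M0: "0 < real (card ?M)"
      using matchings_nonempty by (simp add: card_gt_0_iff)
    have "measure_pmf.prob (graph n) {G. \<not> real (card {v \<in> {1..n}. real n powr a < score n G v}) \<le> x n}
        = real (card {\<sigma> \<in> ?M. x n < real (card {v \<in> {1..n}. 3 * \<tau> < rank \<sigma> v})}) / real (card ?M)"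
      by (simp only: prob_graph[OF n(1)] threshold not_le)
    also have "\<dots> \<le> real n * (real n powr (- s)) ^ p + real n powr (2 * s - a) * S n / x n"
      using main M0 by (simp add: pos_divide_le_eq)
    also have "real n * (real n powr (- s)) ^ p \<le> 1 / real n"
    proof -
      have "(real n powr (- s)) ^ p = real n powr (- s * real p)"
        unfolding powr_powr[symmetric] using n by (subst powr_realpow) auto
      then have "real n * (real n powr (- s)) ^ p = real n powr (1 - s * real p)"
        using n powr_mult_base[of "real n" "- s * real p"] by simp
      also have "\<dots> \<le> real n powr - 1"
        using ps n by (intro powr_mono) auto
      finally show ?thesis
        using n by (simp add: powr_minus_divide)
    qed
    finally show ?case
      by simp
  qed
  moreover have "(\<lambda>n. 1 / real n + real n powr (2 * s - a) * S n / x n) \<longlonglongrightarrow> 0 + 0"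
    by (intro tendsto_add lim lim_1_over_n)
  ultimately show ?thesis
    by (intro whpI) auto
qed

end

section \<open>The three power-law bounds, at fixed exponents and then uniformly\<close>

context pagerank_sequence
begin

abbreviation score_law :: "nat \<Rightarrow> (nat \<times> nat) multiset \<Rightarrow> real pmf" where
  "score_law n G \<equiv> empirical_measure n (score n G)"

abbreviation degree_law :: "nat \<Rightarrow> real pmf" where
  "degree_law n \<equiv> empirical_measure n (\<lambda>v. real (dm n v))"

lemma degree_law:
  assumes "0 < \<epsilon>" "0 < a" "a < 1 / \<kappa>"
  shows "\<forall>\<^sub>F n in sequentially. pl_lower \<kappa> \<epsilon> a n (degree_law n)"
    and "\<forall>\<^sub>F n in sequentially. pl_cutoff \<kappa> \<epsilon> n (degree_law n)"
proof -
  have "\<forall>\<^sub>F n in sequentially. pl_lower \<kappa> \<epsilon> a n (degree_law n) \<and>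
      pl_upper \<kappa> \<epsilon> a n (degree_law n) \<and> pl_cutoff \<kappa> \<epsilon> n (degree_law n)"
    using in_degrees assms unfolding power_law_def by simp
  then show "\<forall>\<^sub>F n in sequentially. pl_lower \<kappa> \<epsilon> a n (degree_law n)"
    "\<forall>\<^sub>F n in sequentially. pl_cutoff \<kappa> \<epsilon> n (degree_law n)"
    by (auto elim: eventually_mono)
qed

text \<open>The in-degrees above \<open>n powr (a - 2 * s)\<close> sum to about
  \<open>n powr (1 + a * (1 - \<kappa>))\<close>; division by \<open>n powr a\<close> turns this
  into the required count \<open>n powr (1 - a * \<kappa>)\<close>.\<close>

lemma whp_upper:
  assumes \<epsilon>: "0 < \<epsilon>" and a: "0 < a" "a < 1 / \<kappa>"
  shows "whp graph (\<lambda>n G. pl_upper \<kappa> \<epsilon> a n (score_law n G))"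
proof (rule whp_mono)
  define s where "s = min (a / 3) (\<epsilon> / (2 * (1 + 2 * \<kappa>)))"
  define S where "S = (\<lambda>n::nat. real n powr (1 + (a - 2 * s) * (1 - \<kappa>) + s))"
  define x where "x = (\<lambda>n::nat. real n powr (1 - a * \<kappa> + \<epsilon>))"
  have s: "0 < s" "3 * s \<le> a"
    using \<epsilon> a kappa by (auto simp: s_def)
  have "s * (1 + 2 * \<kappa>) \<le> \<epsilon> / (2 * (1 + 2 * \<kappa>)) * (1 + 2 * \<kappa>)"
    using kappa by (intro mult_right_mono) (auto simp: s_def)
  also have "\<dots> = \<epsilon> / 2"
    using kappa by (simp add: field_simps)
  finally have s\<epsilon>: "s * (1 + 2 * \<kappa>) < \<epsilon>"
    using \<epsilon> by simp
  show "whp graph (\<lambda>n G. real (card {v \<in> {1..n}. real n powr a < score n G v}) \<le> x n)"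
  proof (rule whp_few_large_scores[OF s])
    show "\<forall>\<^sub>F n in sequentially.
        (\<Sum>v\<in>{v \<in> {1..n}. real n powr (a - 2 * s) < real (dm n v)}. real (dm n v)) \<le> S n"
      unfolding S_def using s a kappa by (intro power_law_sum_above[OF in_degrees]) auto
    show "\<forall>\<^sub>F n in sequentially. 0 < x n"
      using eventually_gt_at_top[of 0] by eventually_elim (simp add: x_def)
    have "real n powr (2 * s - a) * S n / x n = real n powr (s * (1 + 2 * \<kappa>) - \<epsilon>)" for n
      unfolding S_def x_def
      by (simp only: powr_add[symmetric] powr_diff[symmetric]) (simp add: algebra_simps)
    moreover have "(\<lambda>n::nat. real n powr (s * (1 + 2 * \<kappa>) - \<epsilon>)) \<longlonglongrightarrow> 0"
      using s\<epsilon> by (intro tendsto_neg_powr filterlim_real_sequentially) auto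
    ultimately show "(\<lambda>n. real n powr (2 * s - a) * S n / x n) \<longlonglongrightarrow> 0"
      by simp
  qed
  show "\<forall>\<^sub>F n in sequentially. \<forall>G\<in>set_pmf (graph n).
      real (card {v \<in> {1..n}. real n powr a < score n G v}) \<le> x n \<longrightarrow> pl_upper \<kappa> \<epsilon> a n (score_law n G)"
    using eventually_ge_at_top[of 1]
  proof eventually_elim
    case (elim n)
    have "x n = real n * real n powr (- a * \<kappa> + \<epsilon>)"
      using elim powr_mult_base[of "real n" "- a * \<kappa> + \<epsilon>"] by (simp add: x_def algebra_simps)
    then show ?case
      unfolding pl_upper_def using elim
      by (auto simp: tail_empirical_measure pos_divide_le_eq mult.commute)
  qed
qed

text \<open>Above \<open>1 / \<kappa>\<close> even the lowered threshold \<open>a - 2 * s\<close>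
  exceeds the cutoff of the in-degrees. Hence \<open>B\<close> is empty and no mass passes through
  it.\<close>

lemma whp_cutoff:
  assumes \<epsilon>: "0 < \<epsilon>"
  shows "whp graph (\<lambda>n G. pl_cutoff \<kappa> \<epsilon> n (score_law n G))"
proof (rule whp_mono)
  define a where "a = 1 / \<kappa> + \<epsilon>"
  define s where "s = min (a / 3) (\<epsilon> / 4)"
  have a: "0 < a"
    using \<epsilon> kappa by (simp add: a_def add_pos_pos)
  then have s: "0 < s" "3 * s \<le> a"
    using \<epsilon> by (auto simp: s_def)
  have as: "1 / \<kappa> + \<epsilon> / 2 \<le> a - 2 * s"
    by (auto simp: a_def s_def min_def)
  have "\<forall>\<^sub>F n in sequentially. pl_cutoff \<kappa> (\<epsilon> / 2) n (degree_law n)"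
    using \<epsilon> kappa by (intro degree_law(2)[where a = "1 / (2 * \<kappa>)"]) (auto simp: field_simps)
  then have S: "\<forall>\<^sub>F n in sequentially.
      (\<Sum>v\<in>{v \<in> {1..n}. real n powr (a - 2 * s) < real (dm n v)}. real (dm n v)) \<le> 0"
    using eventually_ge_at_top[of 1]
  proof eventually_elim
    case (elim n)
    have "{v \<in> {1..n}. real n powr (1 / \<kappa> + \<epsilon> / 2) < real (dm n v)} = {}"
      using elim tail_empirical_measure[OF elim(2), of "\<lambda>v. real (dm n v)"] by (simp add: pl_cutoff_def)
    moreover have "real n powr (1 / \<kappa> + \<epsilon> / 2) \<le> real n powr (a - 2 * s)"
      using as elim by (intro powr_mono) auto
    ultimately have "{v \<in> {1..n}. real n powr (a - 2 * s) < real (dm n v)} = {}"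
      by fastforce
    then show ?case
      by (simp only: sum.empty)
  qed
  \<comment> \<open>A count of at most \<open>1 / 2\<close> is zero.\<close>
  show "whp graph (\<lambda>n G. real (card {v \<in> {1..n}. real n powr a < score n G v}) \<le> 1 / 2)"
    by (rule whp_few_large_scores[OF s S]) auto
  show "\<forall>\<^sub>F n in sequentially. \<forall>G\<in>set_pmf (graph n).
      real (card {v \<in> {1..n}. real n powr a < score n G v}) \<le> 1 / 2 \<longrightarrow> pl_cutoff \<kappa> \<epsilon> n (score_law n G)"
    using eventually_ge_at_top[of 1]
  proof eventually_elim
    case (elim n)
    have "real k / real n = 0" if "real k \<le> 1 / 2" for k :: nat
      using that by simp
    then show ?case
      unfolding pl_cutoff_def a_def[symmetric] tail_empirical_measure[OF elim] by blast
  qed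
qed

text \<open>By \<open>rank_ge\<close>, a score is at least the in-degree up to a factor
  \<open>n powr (- 2 * s)\<close>, so every vertex of in-degree above
  \<open>n powr (a + 2 * s)\<close> has score above \<open>n powr a\<close>. This holds on every
  graph in the support.\<close>

lemma eventually_lower:
  assumes \<epsilon>: "0 < \<epsilon>" and a: "0 < a" "a < 1 / \<kappa>"
  shows "\<forall>\<^sub>F n in sequentially. \<forall>G\<in>set_pmf (graph n). pl_lower \<kappa> \<epsilon> a n (score_law n G)"
proof -
  \<comment> \<open>The loss \<open>s * (1 + 2 * \<kappa>)\<close> in the exponent must stay within
    \<open>\<epsilon>\<close>, and \<open>a + 2 * s\<close> must remain below
    \<open>1 / \<kappa>\<close>.\<close>
  define s where "s = min (\<epsilon> / (1 + 2 * \<kappa>)) ((1 / \<kappa> - a) / 4)"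
  have s: "0 < s"
    using \<epsilon> a kappa by (simp add: s_def)
  have "s * (1 + 2 * \<kappa>) \<le> \<epsilon> / (1 + 2 * \<kappa>) * (1 + 2 * \<kappa>)"
    using kappa by (intro mult_right_mono) (auto simp: s_def)
  then have s\<epsilon>: "s * (1 + 2 * \<kappa>) \<le> \<epsilon>"
    using kappa by simp
  have "s \<le> (1 / \<kappa> - a) / 4"
    unfolding s_def by (rule min.cobounded2)
  then have as: "0 < a + 2 * s" "a + 2 * s < 1 / \<kappa>"
    using s a by (auto simp: field_simps)
  define k where "k = \<alpha> * (1 - \<alpha>) / K"
  have "2 \<le> K"
    using min_out[of 1 1] max_out[of 1 1] by simp
  then have K: "0 < K"
    by simp
  then have k: "0 < k"
    using alpha by (simp add: k_def)
  have k_ev: "\<forall>\<^sub>F n in sequentially. real n powr (- s) \<le> k"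
    using s k by real_asymp
  show ?thesis
    using lam_bounds[OF s] degree_law(1)[OF s as] k_ev eventually_ge_at_top[of 1]
  proof eventually_elim
    case (elim n)
    then have n: "1 \<le> n" "0 < real n" "1 \<le> real n"
      by auto
    interpret pagerank_model n "dm n" "dp n" \<alpha> "lam n"
      by (rule model[OF n(1)])
    show ?case
    proof
      fix G assume "G \<in> set_pmf (graph n)"
      then obtain \<sigma> where \<sigma>: "\<sigma> \<in> matchings n (dm n) (dp n)" and G: "G = graph_of_matching n (dp n) \<sigma>"
        unfolding set_pmf_graph[OF n(1)] by blast
      have large: "real n powr a < score n G v"
        if v: "v \<in> {1..n}" "real n powr (a + 2 * s) < real (dm n v)" for v
      proof -
        have "real n powr a = real n powr (- s) * real n powr (- s) * real n powr (a + 2 * s)"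
          by (simp only: powr_add[symmetric]) simp
        also have "\<dots> < real n powr (- s) * real n powr (- s) * real (dm n v)"
          using v n by (intro mult_strict_left_mono) auto
        also have "\<dots> \<le> k * real n powr (- s) * real (dm n v)"
          using elim(3) by (intro mult_right_mono) auto
        also have "\<dots> = real n * (\<alpha> * (1 - \<alpha>) * real n powr (- 1 - s) / K * real (dm n v))"
        proof -
          have "real n powr (- s) = real n * real n powr (- 1 - s)"
            using n powr_mult_base[of "real n" "- 1 - s"] by simp
          then show ?thesis
            by (simp only: k_def times_divide_eq_left times_divide_eq_right mult_ac)
        qed
        also have "\<dots> \<le> real n * rank \<sigma> v"
          using elim(1) n by (intro mult_left_mono rank_ge[OF \<sigma> v(1) max_out]) auto
        finally show ?thesis
          by (simp add: G)
      qed
      have "real n powr (- a * \<kappa> - \<epsilon>) \<le> real n powr (- (a + 2 * s) * \<kappa> - s)"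
        using s\<epsilon> n by (intro powr_mono) (auto simp: algebra_simps)
      also have "\<dots> \<le> tail (degree_law n) (real n powr (a + 2 * s))"
        using elim(2) by (simp only: pl_lower_def)
      also have "\<dots> \<le> tail (score_law n G) (real n powr a)"
        unfolding tail_empirical_measure[OF n(1)] using large
        by (intro divide_right_mono of_nat_mono card_mono) auto
      finally show "pl_lower \<kappa> \<epsilon> a n (score_law n G)"
        by (simp only: pl_lower_def)
    qed
  qed
qed

text \<open>Since \<open>tail\<close> is monotone, bounds on a finite grid of exponents \<open>a\<close> of mesh about
  \<open>\<epsilon> / (2 * \<kappa>)\<close> suffice.\<close>

lemma whp_upper_uniform:
  assumes \<epsilon>: "0 < \<epsilon>"
  shows "whp graph (\<lambda>n G. \<forall>a\<in>{0<..<1/\<kappa>}. pl_upper \<kappa> \<epsilon> a n (score_law n G))"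
proof -
  obtain J :: nat where J: "2 / \<epsilon> < real J"
    using reals_Archimedean2 by blast
  have J0: "0 < real J"
    using J \<epsilon> by (smt (verit) divide_pos_pos)
  have J\<epsilon>: "1 / real J \<le> \<epsilon> / 2"
    using J J0 \<epsilon> by (simp add: field_simps)
  let ?b = "\<lambda>j::nat. real j / (\<kappa> * real J)"
  have "0 < ?b j" "?b j < 1 / \<kappa>" if "j \<in> {1..<J}" for j
    using that kappa J0 by (auto simp: field_simps)
  then have "whp graph (\<lambda>n G. \<forall>j\<in>{1..<J}. pl_upper \<kappa> (\<epsilon> / 2) (?b j) n (score_law n G))"
    using \<epsilon> by (intro whp_ball_finite whp_upper) auto
  moreover have "\<forall>\<^sub>F n in sequentially. \<forall>G\<in>set_pmf (graph n).
      (\<forall>j\<in>{1..<J}. pl_upper \<kappa> (\<epsilon> / 2) (?b j) n (score_law n G)) \<longrightarrow>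
      (\<forall>a\<in>{0<..<1/\<kappa>}. pl_upper \<kappa> \<epsilon> a n (score_law n G))"
    using eventually_ge_at_top[of 1]
  proof (eventually_elim, intro ballI impI)
    fix n G a
    assume "1 \<le> n" and grid: "\<forall>j\<in>{1..<J}. pl_upper \<kappa> (\<epsilon> / 2) (?b j) n (score_law n G)"
      and a: "a \<in> {0<..<1/\<kappa>}"
    then have n: "1 \<le> real n"
      by simp
    \<comment> \<open>Round \<open>a\<close> down to the grid: the tail at \<open>n powr a\<close>
      is at most the tail at the smaller grid point.\<close>
    define j where "j = nat \<lfloor>a * \<kappa> * real J\<rfloor>"
    have pos: "0 \<le> a * \<kappa> * real J"
      using a kappa J0 by simp
    have "a * \<kappa> < 1"
      using a kappa by (simp add: field_simps)
    then have "a * \<kappa> * real J < 1 * real J"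
      using J0 by (intro mult_strict_right_mono)
    moreover have j: "real j \<le> a * \<kappa> * real J" "a * \<kappa> * real J < real j + 1"
      unfolding j_def using pos by linarith+
    ultimately have jJ: "j < J"
      by linarith
    have "a * \<kappa> < (real j + 1) / real J"
      using j J0 by (simp add: pos_less_divide_eq)
    then have step_bound: "- (real j / real J) \<le> - (a * \<kappa>) + \<epsilon> / 2"
      using J\<epsilon> by (simp add: add_divide_distrib)
    have "tail (score_law n G) (real n powr a) \<le> real n powr (- (real j / real J) + \<epsilon> / 2)"
    \<comment> \<open>Below the first grid point \<open>a * \<kappa>\<close> is less than
      \<open>\<epsilon> / 2\<close>, and the trivial bound 1 suffices.\<close>
    proof (cases "j = 0")
      case True
      have "tail (score_law n G) (real n powr a) \<le> 1"
        by simp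
      also have "\<dots> \<le> real n powr (- (real j / real J) + \<epsilon> / 2)"
        using True n \<epsilon> by (intro ge_one_powr_ge_zero) auto
      finally show ?thesis .
    next
      case False
      have "?b j \<le> a"
        using j kappa J0 by (simp add: field_simps)
      then have "tail (score_law n G) (real n powr a) \<le> tail (score_law n G) (real n powr ?b j)"
        using n by (intro tail_antimono powr_mono)
      also have "\<dots> \<le> real n powr (- ?b j * \<kappa> + \<epsilon> / 2)"
        using grid False jJ by (simp add: pl_upper_def)
      also have "- ?b j * \<kappa> = - (real j / real J)"
        using kappa by simp
      finally show ?thesis .
    qed
    also have "\<dots> \<le> real n powr (- a * \<kappa> + \<epsilon>)"
      using n step_bound by (intro powr_mono) auto
    finally show "pl_upper \<kappa> \<epsilon> a n (score_law n G)"
      by (simp only: pl_upper_def)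
  qed
  ultimately show ?thesis
    by (rule whp_mono)
qed

text \<open>For a lower bound \<open>a\<close> is rounded up. The grid therefore ends at
  \<open>b\<close> itself, and \<open>b < 1 / \<kappa>\<close> keeps all grid points in the range of
  the power law.\<close>

lemma eventually_lower_uniform:
  assumes \<epsilon>: "0 < \<epsilon>" and b: "0 < b" "b < 1 / \<kappa>"
  shows "\<forall>\<^sub>F n in sequentially. \<forall>G\<in>set_pmf (graph n). \<forall>a\<in>{0<..b}. pl_lower \<kappa> \<epsilon> a n (score_law n G)"
proof -
  obtain J :: nat where J: "2 / \<epsilon> < real J"
    using reals_Archimedean2 by blast
  have J0: "0 < real J"
    using J \<epsilon> by (smt (verit) divide_pos_pos)
  have J\<epsilon>: "1 / real J \<le> \<epsilon> / 2"
    using J J0 \<epsilon> by (simp add: field_simps)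
  have b\<kappa>: "b * \<kappa> < 1"
    using b kappa by (simp add: field_simps)
  let ?b = "\<lambda>j::nat. b * (real j / real J)"
  have grid: "0 < ?b j" "?b j < 1 / \<kappa>" if "j \<in> {1..J}" for j
  proof -
    show "0 < ?b j"
      using that b J0 by simp
    have "?b j \<le> b * 1"
      using that b J0 by (intro mult_left_mono) auto
    then show "?b j < 1 / \<kappa>"
      using b by linarith
  qed
  have "\<forall>\<^sub>F n in sequentially. \<forall>j\<in>{1..J}. \<forall>G\<in>set_pmf (graph n). pl_lower \<kappa> (\<epsilon> / 2) (?b j) n (score_law n G)"
    using grid \<epsilon> by (intro eventually_ball_finite ballI eventually_lower) auto
  then show ?thesis
    using eventually_ge_at_top[of 1]
  proof (eventually_elim, intro ballI)
    fix n G a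
    assume lower: "\<forall>j\<in>{1..J}. \<forall>G\<in>set_pmf (graph n). pl_lower \<kappa> (\<epsilon> / 2) (?b j) n (score_law n G)"
      and "1 \<le> n" and G: "G \<in> set_pmf (graph n)" and a: "a \<in> {0<..b}"
    then have n: "1 \<le> real n"
      by simp
    define j where "j = nat \<lceil>a / b * real J\<rceil>"
    have pos: "0 < a / b * real J"
      using a b J0 by simp
    then have j: "a / b * real J \<le> real j" "real j < a / b * real J + 1"
      unfolding j_def by linarith+
    have "a / b * real J \<le> 1 * real J"
      using a b J0 by (intro mult_right_mono) auto
    then have "real j < real J + 1" "0 < real j"
      using j pos by linarith+
    then have jJ: "j \<in> {1..J}"
      by auto
    have "a \<le> ?b j"
      using j b J0 by (simp add: field_simps)
    have "?b j * \<kappa> \<le> b * ((a / b * real J + 1) / real J) * \<kappa>"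
      using j b J0 kappa by (intro mult_right_mono mult_left_mono divide_right_mono) auto
    also have "\<dots> = a * \<kappa> + b * \<kappa> * (1 / real J)"
      using b J0 by (simp add: field_simps)
    also have "\<dots> \<le> a * \<kappa> + 1 * (1 / real J)"
      using b\<kappa> J0 by (intro add_left_mono mult_right_mono) auto
    finally have bound: "?b j * \<kappa> \<le> a * \<kappa> + \<epsilon> / 2"
      using J\<epsilon> by linarith
    have "real n powr (- a * \<kappa> - \<epsilon>) \<le> real n powr (- ?b j * \<kappa> - \<epsilon> / 2)"
      using n bound by (intro powr_mono) auto
    also have "\<dots> \<le> tail (score_law n G) (real n powr ?b j)"
      using lower jJ G by (simp only: pl_lower_def)
    also have "\<dots> \<le> tail (score_law n G) (real n powr a)"
      using n \<open>a \<le> ?b j\<close> by (intro tail_antimono powr_mono)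
    finally show "pl_lower \<kappa> \<epsilon> a n (score_law n G)"
      by (simp only: pl_lower_def)
  qed
qed

lemma power_law_whp_score: "power_law_whp \<kappa> graph score_law"
  unfolding power_law_whp_def
proof (intro conjI allI impI ballI)
  show "0 < \<kappa>"
    using kappa by simp
  fix \<epsilon> b :: real
  assume \<epsilon>: "0 < \<epsilon>" and b: "b \<in> {0<..<1/\<kappa>}"
  have "whp graph (\<lambda>n G. pl_cutoff \<kappa> \<epsilon> n (score_law n G) \<and>
      (\<forall>a\<in>{0<..<1/\<kappa>}. pl_upper \<kappa> \<epsilon> a n (score_law n G)))"
    by (intro whp_conj whp_cutoff whp_upper_uniform \<epsilon>)
  then show "whp graph (\<lambda>n G. pl_cutoff \<kappa> \<epsilon> n (score_law n G) \<and>
      (\<forall>a\<in>{0<..<1/\<kappa>}. pl_upper \<kappa> \<epsilon> a n (score_law n G)) \<and>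
      (\<forall>a\<in>{0<..b}. pl_lower \<kappa> \<epsilon> a n (score_law n G)))"
  proof (rule whp_mono)
    have "0 < b" "b < 1 / \<kappa>"
      using b by auto
    \<comment> \<open>The lower bound eventually holds on the whole support, so adding it to the
      event costs no probability.\<close>
    from eventually_lower_uniform[OF \<epsilon> this]
    show "\<forall>\<^sub>F n in sequentially. \<forall>G\<in>set_pmf (graph n).
      pl_cutoff \<kappa> \<epsilon> n (score_law n G) \<and> (\<forall>a\<in>{0<..<1/\<kappa>}. pl_upper \<kappa> \<epsilon> a n (score_law n G)) \<longrightarrow>
      pl_cutoff \<kappa> \<epsilon> n (score_law n G) \<and> (\<forall>a\<in>{0<..<1/\<kappa>}. pl_upper \<kappa> \<epsilon> a n (score_law n G)) \<and>
      (\<forall>a\<in>{0<..b}. pl_lower \<kappa> \<epsilon> a n (score_law n G))"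
      by (rule eventually_mono) blast
  qed
qed

end

theorem theorem1p9:
  fixes dm dp :: "nat \<Rightarrow> nat \<Rightarrow> nat"
    and lam :: "nat \<Rightarrow> nat pmf"
    and \<eta> C K \<kappa> \<alpha> :: real
  assumes bidegree: "\<And>n. n \<ge> 1 \<Longrightarrow> (\<Sum>v\<in>{1..n}. dp n v) = (\<Sum>v\<in>{1..n}. dm n v)"
    and constants: "\<eta> > 0" "C > 0" "K \<ge> 2"
    and min_out: "\<And>n v. v \<in> {1..n} \<Longrightarrow> dp n v \<ge> 2"
    and max_out: "\<And>n v. v \<in> {1..n} \<Longrightarrow> real (dp n v) \<le> K"
    and moment: "\<And>n. n \<ge> 1 \<Longrightarrow> (\<Sum>v\<in>{1..n}. real (dm n v) powr (2 + \<eta>)) \<le> C * real n"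
    and kappa: "\<kappa> > 2"
    and in_degrees: "power_law \<kappa> (\<lambda>n. empirical_measure n (\<lambda>v. real (dm n v)))"
    and alpha: "\<alpha> \<in> {0<..<1}"
    and lam_on: "\<And>n. n \<ge> 1 \<Longrightarrow> set_pmf (lam n) \<subseteq> {1..n}"
    and lam_bounds: "\<And>\<epsilon>::real. \<epsilon> > 0 \<Longrightarrow> \<forall>\<^sub>F n in sequentially. \<forall>x\<in>{1..n}.
          real n powr (- 1 - \<epsilon>) \<le> pmf (lam n) x \<and> pmf (lam n) x \<le> real n powr (- 1 + \<epsilon>)"
  shows "power_law_whp \<kappa> (\<lambda>n. dcm n (dm n) (dp n))
           (\<lambda>n G. empirical_measure n
              (\<lambda>v. real n * pmf (pagerank n \<alpha> (lam n) (srw_matrix (dp n) G)) v))"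
proof -
  interpret pagerank_sequence dm dp lam K \<kappa> \<alpha>
    using assms by unfold_locales auto
  show ?thesis
    by (rule power_law_whp_score)
qed

end
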